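(* Let $\mathbf X$ be a Euclidean space, let $f:\mathbf X\to[-\infty,+\infty]$ be prox-regular and subdifferentially continuous at $\bar x$ for $\bar v=0$, and let $\kappa>0$. Then the following properties are equivalent. (a) The point $\bar x$ is a tilt-stable local minimizer of $f$ with constant $\kappa$. (b) There is a constant $\eta>0$ such that for all $w\in\mathbf X$ we have $\mathrm d^2 f(x,v)(w)\ge \frac1\kappa\|w\|^2$ for all $(x,v)\in(\mathrm{gph}\,\partial f)\cap\mathbb B_\eta(\bar x,0)$ such that $f$ is twice epi-differentiable at $x$ for $v$. (c) There is a constant $\eta>0$ such that for all $w\in\mathbf X$ we have $\mathrm d^2 f(x,v)(w)\ge \frac1\kappa\|w\|^2$ for all $(x,v)\in(\mathrm{gph}\,\partial f)\cap\mathbb B_\eta(\bar x,0)$ at which $\mathrm d^2 f(x,v)$ is a generalized quadratic form (GQF).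
   Context: Euclidean spaces are finite-dimensional; $\mathbb B_r(z)$ is the closed ball of radius $r$ centered at $z$. $\partial f$ is the limiting (Mordukhovich) subdifferential and $\mathrm{gph}\,\partial f=\{(x,v): v\in\partial f(x)\}$. Prox-regularity: $f$ is prox-regular at $\bar x$ for $\bar v$ if $f$ is finite at $\bar x$ and locally lower semicontinuous around $\bar x$ with $\bar v\in\partial f(\bar x)$, and there exist $\varepsilon>0$, $r\ge0$ such that $f(x')\ge f(x)+\langle v,x'-x\rangle-\frac r2\|x'-x\|^2$ for all $x'\in\mathbb B_\varepsilon(\bar x)$ whenever $(x,v)\in(\mathrm{gph}\,\partial f)\cap\mathbb B_\varepsilon(\bar x,\bar v)$ with $f(x)<f(\bar x)+\varepsilon$. Subdifferential continuity: $f$ is subdifferentially continuous at $\bar x$ for $\bar v$ if $(x^k,v^k)\to(\bar x,\bar v)$ with $v^k\in\partial f(x^k)$ implies $f(x^k)\to f(\bar x)$. Second subderivative: for $f(x)$ finite, set $\Delta_t^2f(x,v)(u)=\dfrac{f(x+tu)-f(x)-t\langle v,u\rangle}{\frac12t^2}$ and $\mathrm d^2f(x,v)(w)=\liminf_{t\searrow0,\,u\to w}\Delta_t^2f(x,v)(u)$. $f$ is twice epi-differentiable at $x$ for $v$ if $\Delta^2_tf(x,v)$ epi-converges to $\mathrm d^2f(x,v)$ as $t\searrow0$ (i.e. the epigraphs converge in the Painlevé–Kuratowski sense). GQF: a proper function $\varphi:\mathbf X\to[-\infty,+\infty]$ is a generalized quadratic form if $\mathrm{dom}\,\varphi$ is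 a linear subspace and there is a linear operator $L:\mathrm{dom}\,\varphi\to\mathbf X$ with $\langle Lx,y\rangle=\langle x,Ly\rangle$ for all $x,y\in\mathrm{dom}\,\varphi$ such that $\varphi(x)=\langle Lx,x\rangle$ for all $x\in\mathrm{dom}\,\varphi$. Tilt stability: $\bar x$ is a tilt-stable local minimizer of $f$ with constant $\kappa>0$ if $f(\bar x)$ is finite and there is $\gamma>0$ such that the mapping $M_\gamma: v\mapsto\operatorname{argmin}\{f(x)-\langle v,x\rangle : x\in\mathbb B_\gamma(\bar x)\}$ is single-valued and Lipschitz continuous with constant $\kappa$ on a neighborhood of $0$, with $M_\gamma(0)=\{\bar x\}$. *)

theory Defs
  imports "HOL-Analysis.Analysis"
begin

definition finite_at :: "('a \<Rightarrow> ereal) \<Rightarrow> 'a \<Rightarrow> bool" where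
  "finite_at f x \<longleftrightarrow> \<bar>f x\<bar> \<noteq> \<infinity>"

text \<open>The regular (Frechet) subdifferential: \<open>f y \<ge> f x + v \<bullet> (y - x) + o(norm (y - x))\<close>.\<close>

definition regular_subdiff :: "('a::euclidean_space \<Rightarrow> ereal) \<Rightarrow> 'a \<Rightarrow> 'a set" where
  "regular_subdiff f x =
     {v. finite_at f x \<and>
         0 \<le> Liminf (at x) (\<lambda>y. (f y - f x - ereal (v \<bullet> (y - x))) / ereal (norm (y - x)))}"

text \<open>The limiting (Mordukhovich) subdifferential; the approximating sequences are
  \<open>f\<close>-attentive, i.e. the function values converge as well. It is empty where \<open>f\<close> is
  not finite.\<close>

definition limiting_subdiff :: "('a::euclidean_space \<Rightarrow> ereal) \<Rightarrow> 'a \<Rightarrow> 'a set" where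
  "limiting_subdiff f x =
     {v. finite_at f x \<and>
         (\<exists>X V. X \<longlonglongrightarrow> x \<and> (\<lambda>k. f (X k)) \<longlonglongrightarrow> f x \<and> V \<longlonglongrightarrow> v \<and>
                (\<forall>k. V k \<in> regular_subdiff f (X k)))}"

definition gph_subdiff :: "('a::euclidean_space \<Rightarrow> ereal) \<Rightarrow> ('a \<times> 'a) set" where
  "gph_subdiff f = {(x, v). v \<in> limiting_subdiff f x}"

text \<open>Local lower semicontinuity at a point of finiteness in the sense of Rockafellar and Wets
  (Variational Analysis, Definition 1.33), equivalently: the epigraph of \<open>f\<close> is locally closed
  at \<open>(xbar, f xbar)\<close>. It holds in particular whenever \<open>f\<close> is lower semicontinuous at every
  point of a neighborhood of \<open>xbar\<close>.\<close>

definition locally_lsc :: "('a::euclidean_space \<Rightarrow> ereal) \<Rightarrow> 'a \<Rightarrow> bool" where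
  "locally_lsc f xbar \<longleftrightarrow>
     (\<exists>e>0. \<forall>\<alpha>::real. ereal \<alpha> \<le> f xbar + ereal e \<longrightarrow>
        closed {x \<in> cball xbar e. f x \<le> ereal \<alpha>})"

definition prox_regular :: "('a::euclidean_space \<Rightarrow> ereal) \<Rightarrow> 'a \<Rightarrow> 'a \<Rightarrow> bool" where
  "prox_regular f xbar vbar \<longleftrightarrow>
     finite_at f xbar \<and> locally_lsc f xbar \<and> vbar \<in> limiting_subdiff f xbar \<and>
     (\<exists>e>0. \<exists>r\<ge>0. \<forall>x v.
        (x, v) \<in> gph_subdiff f \<inter> cball (xbar, vbar) e \<and> f x < f xbar + ereal e \<longrightarrow>
        (\<forall>x'\<in>cball xbar e.
           f x' \<ge> f x + ereal (v \<bullet> (x' - x) - r / 2 * (norm (x' - x))\<^sup>2)))"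

definition subdiff_continuous :: "('a::euclidean_space \<Rightarrow> ereal) \<Rightarrow> 'a \<Rightarrow> 'a \<Rightarrow> bool" where
  "subdiff_continuous f xbar vbar \<longleftrightarrow>
     (\<forall>X V. (\<lambda>k. (X k, V k)) \<longlonglongrightarrow> (xbar, vbar) \<and> (\<forall>k. V k \<in> limiting_subdiff f (X k)) \<longrightarrow>
        (\<lambda>k. f (X k)) \<longlonglongrightarrow> f xbar)"

text \<open>The next two definitions are meant for points \<open>x\<close> with \<open>f x\<close> finite.\<close>

definition second_diff_quot ::
    "('a::euclidean_space \<Rightarrow> ereal) \<Rightarrow> 'a \<Rightarrow> 'a \<Rightarrow> real \<Rightarrow> 'a \<Rightarrow> ereal" where
  "second_diff_quot f x v t u =
     (f (x + t *\<^sub>R u) - f x - ereal (t * (v \<bullet> u))) / ereal (1 / 2 * t\<^sup>2)"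

definition second_subderiv ::
    "('a::euclidean_space \<Rightarrow> ereal) \<Rightarrow> 'a \<Rightarrow> 'a \<Rightarrow> 'a \<Rightarrow> ereal" where
  "second_subderiv f x v w =
     Liminf (at_right 0 \<times>\<^sub>F nhds w) (\<lambda>(t, u). second_diff_quot f x v t u)"

definition epi :: "('a \<Rightarrow> ereal) \<Rightarrow> ('a \<times> real) set" where
  "epi \<phi> = {(x, \<alpha>). \<phi> x \<le> ereal \<alpha>}"

text \<open>Painleve--Kuratowski outer and inner limits of a family of sets \<open>C t\<close> as \<open>t\<close> decreases
  to \<open>0\<close>. In the inner limit membership is required for all large \<open>k\<close> only, since finitely
  many of the sets may be empty.\<close>

definition outer_limit :: "(real \<Rightarrow> 'b::topological_space set) \<Rightarrow> 'b set" where
  "outer_limit C =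
     {z. \<exists>T Z. filterlim T (at_right 0) sequentially \<and> (\<forall>k. Z k \<in> C (T k)) \<and> Z \<longlonglongrightarrow> z}"

definition inner_limit :: "(real \<Rightarrow> 'b::topological_space set) \<Rightarrow> 'b set" where
  "inner_limit C =
     {z. \<forall>T. filterlim T (at_right 0) sequentially \<longrightarrow>
           (\<exists>Z. (\<forall>\<^sub>F k in sequentially. Z k \<in> C (T k)) \<and> Z \<longlonglongrightarrow> z)}"

definition PK_converges :: "(real \<Rightarrow> 'b::topological_space set) \<Rightarrow> 'b set \<Rightarrow> bool" where
  "PK_converges C D \<longleftrightarrow> outer_limit C = D \<and> inner_limit C = D"

definition epi_converges :: "(real \<Rightarrow> 'a::euclidean_space \<Rightarrow> ereal) \<Rightarrow> ('a \<Rightarrow> ereal) \<Rightarrow> bool" where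
  "epi_converges \<Phi> \<phi> \<longleftrightarrow> PK_converges (\<lambda>t. epi (\<Phi> t)) (epi \<phi>)"

definition twice_epi_differentiable ::
    "('a::euclidean_space \<Rightarrow> ereal) \<Rightarrow> 'a \<Rightarrow> 'a \<Rightarrow> bool" where
  "twice_epi_differentiable f x v \<longleftrightarrow>
     finite_at f x \<and> epi_converges (second_diff_quot f x v) (second_subderiv f x v)"

definition effective_domain :: "('a \<Rightarrow> ereal) \<Rightarrow> 'a set" where
  "effective_domain \<phi> = {x. \<phi> x < \<infinity>}"

definition proper_fun :: "('a \<Rightarrow> ereal) \<Rightarrow> bool" where
  "proper_fun \<phi> \<longleftrightarrow> effective_domain \<phi> \<noteq> {} \<and> (\<forall>x. \<phi> x \<noteq> -\<infinity>)"

text \<open>The operator \<open>L\<close> is only used, and only required to be linear, on the domain of \<open>\<phi>\<close>.\<close>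

definition gen_quadratic_form :: "('a::euclidean_space \<Rightarrow> ereal) \<Rightarrow> bool" where
  "gen_quadratic_form \<phi> \<longleftrightarrow>
     proper_fun \<phi> \<and> subspace (effective_domain \<phi>) \<and>
     (\<exists>L :: 'a \<Rightarrow> 'a.
        (\<forall>x\<in>effective_domain \<phi>. \<forall>y\<in>effective_domain \<phi>. L (x + y) = L x + L y) \<and>
        (\<forall>c. \<forall>x\<in>effective_domain \<phi>. L (c *\<^sub>R x) = c *\<^sub>R L x) \<and>
        (\<forall>x\<in>effective_domain \<phi>. \<forall>y\<in>effective_domain \<phi>. L x \<bullet> y = x \<bullet> L y) \<and>
        (\<forall>x\<in>effective_domain \<phi>. \<phi> x = ereal (L x \<bullet> x)))"

definition tilt_argmin ::
    "('a::euclidean_space \<Rightarrow> ereal) \<Rightarrow> 'a \<Rightarrow> real \<Rightarrow> 'a \<Rightarrow> 'a set" where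
  "tilt_argmin f xbar \<gamma> v =
     {x. is_arg_min (\<lambda>y. f y - ereal (v \<bullet> y)) (\<lambda>y. y \<in> cball xbar \<gamma>) x}"

definition tilt_stable_minimizer ::
    "('a::euclidean_space \<Rightarrow> ereal) \<Rightarrow> 'a \<Rightarrow> real \<Rightarrow> bool" where
  "tilt_stable_minimizer f xbar \<kappa> \<longleftrightarrow>
     finite_at f xbar \<and>
     (\<exists>\<gamma>>0. tilt_argmin f xbar \<gamma> 0 = {xbar} \<and>
        (\<exists>V m. open V \<and> 0 \<in> V \<and> (\<forall>v\<in>V. tilt_argmin f xbar \<gamma> v = {m v}) \<and>
               \<kappa>-lipschitz_on V m))"

end

theory Submission
  imports Defs
begin

text \<open>Put \<open>\<mu> = r + 1\<close>, \<open>F x = f x + \<mu>/2 \<parallel>x - xbar\<parallel>\<^sup>2\<close> and let \<open>P z\<close> be the minimizer of \<open>F - \<langle>z, \<cdot>\<rangle>\<close> near \<open>xbar\<close>.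
  Prox-regularity makes \<open>P\<close> single-valued and 1-Lipschitz near \<open>0\<close>, and \<open>z \<mapsto> (P z, z - \<mu> (P z - xbar))\<close>
  parametrizes the graph of the subdifferential near \<open>(xbar, 0)\<close>. Moreover \<open>P\<close> is the gradient of
  \<open>g z = \<langle>z, P z\<rangle> - F (P z)\<close>.

  Where \<open>P\<close> has a linear directional derivative \<open>A\<close> at \<open>z\<close>, a second order expansion of \<open>g\<close> shows that
  \<open>f\<close> is twice epi-differentiable at the corresponding point, and that its second subderivative is the
  generalized quadratic form \<open>A y \<mapsto> \<langle>y, A y\<rangle> - \<mu> \<parallel>A y\<parallel>\<^sup>2\<close> with domain the range of \<open>A\<close>. By Rademacher's
  theorem this happens at almost every \<open>z\<close>, so either of (b) and (c) gives \<open>\<parallel>A y\<parallel> \<le> c \<parallel>y\<parallel>\<close> almost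
  everywhere with \<open>1/c = \<mu> + 1/\<kappa>\<close>. Hence \<open>P\<close> is \<open>c\<close>-Lipschitz, and by conjugacy \<open>F\<close> grows at rate
  \<open>1/(2c)\<close> and \<open>f\<close> at rate \<open>1/(2\<kappa>)\<close> around each nearby point of the graph, which is tilt stability.

  Conversely, if the argmin map \<open>M\<close> is \<open>\<kappa>\<close>-Lipschitz, conjugacy gives the growth rate \<open>1/(2\<kappa>)\<close> at the
  points \<open>(M v, v)\<close>. These exhaust the graph near \<open>(xbar, 0)\<close> because \<open>v \<mapsto> v + \<mu> (M v - xbar)\<close> is open
  by invariance of domain.\<close>

section \<open>Right derivatives of Lipschitz functions on the line\<close>

lemma AE_lborel_not_in_negligible:
  assumes "negligible (N::'a::euclidean_space set)"
  shows "AE x in lborel. x \<notin> N"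
proof -
  have "AE x in lebesgue. x \<notin> N"
    using assms by (intro AE_not_in) (simp add: negligible_iff_null_sets)
  then show ?thesis by (simp add: AE_completion_iff)
qed

text \<open>This makes the Stieltjes measure of \<open>k\<close> absolutely continuous with respect
  to Lebesgue measure, since it is dominated by it. The two sides agree on open intervals:
  continuity makes end points null, and the increments of \<open>k\<close> and \<open>k'\<close> add
  up to the length.\<close>

lemma lborel_eq_sum_interval_measures:
  fixes k k' :: "real \<Rightarrow> real"
  assumes mono: "mono k" "mono k'"
    and cont: "continuous_on UNIV k" "continuous_on UNIV k'"
    and sum: "\<And>t. k t + k' t = t"
    and A: "A \<in> sets borel"
  shows "emeasure lborel A = emeasure (interval_measure k) A + emeasure (interval_measure k') A"
proof -
  let ?\<mu> = "\<lambda>A. emeasure (interval_measure k) A + emeasure (interval_measure k') A"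
  define M where "M = measure_of (UNIV::real set) (sets borel) ?\<mu>"
  have setsM: "sets M = sets borel"
    unfolding M_def by (metis sets.sets_measure_of_eq space_borel)
  have em: "emeasure M B = ?\<mu> B" if "B \<in> sets borel" for B
    unfolding M_def
  proof (rule emeasure_measure_of_sigma)
    show "sigma_algebra (UNIV::real set) (sets borel)"
      by (metis sets.sigma_algebra_axioms space_borel)
    show "countably_additive (sets borel) ?\<mu>"
      unfolding countably_additive_def
      by (auto simp: suminf_add[symmetric] suminf_emeasure)
  qed (use that in \<open>auto simp: positive_def\<close>)
  have "lborel = M"
  proof (rule lborel_eqI)
    fix l u :: real assume *: "\<And>b. b \<in> Basis \<Longrightarrow> l \<bullet> b \<le> u \<bullet> b"
    then have lu: "l \<le> u" by auto
    have Ioo: "emeasure (interval_measure \<phi>) (box l u) = ennreal (\<phi> u - \<phi> l)"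
      if "mono \<phi>" "continuous_on UNIV \<phi>" for \<phi> :: "real \<Rightarrow> real"
    proof -
      have m: "\<And>x y. x \<le> y \<Longrightarrow> \<phi> x \<le> \<phi> y" using that(1) by (rule monoD)
      have 1: "emeasure (interval_measure \<phi>) {l..u} = ennreal (\<phi> u - \<phi> l)"
        using emeasure_interval_measure_Icc[OF lu m that(2)] by simp
      have "emeasure (interval_measure \<phi>) {x..x} = ennreal (\<phi> x - \<phi> x)" for x
        by (rule emeasure_interval_measure_Icc[OF order_refl m that(2)])
      then have 0: "emeasure (interval_measure \<phi>) {x} = 0" for x by simp
      have n: "{l,u} \<in> null_sets (interval_measure \<phi>)"
        using 0
        by (metis insert_is_Un null_sets.Un null_setsI sets_interval_measure borel_singleton sets.empty_sets)
      have "box l u = {l..u} - {l,u}" by (auto simp: box_real)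
      then show ?thesis using emeasure_Diff_null_set[OF n, of "{l..u}"] 1 by simp
    qed
    have "emeasure M (box l u) = ennreal (k u - k l) + ennreal (k' u - k' l)"
      using em[of "box l u"] Ioo assms by simp
    also have "\<dots> = ennreal (u - l)"
      using monoD[OF mono(1) lu] monoD[OF mono(2) lu] sum[of u] sum[of l]
      by (subst ennreal_plus[symmetric]) (auto simp: algebra_simps)
    finally show "emeasure M (box l u) = ennreal (\<Prod>b\<in>Basis. (u - l) \<bullet> b)" by simp
  qed (rule setsM)
  then show ?thesis using em[OF A] by simp
qed

text \<open>A Lipschitz function is, up to scaling and adding the identity, a monotone function
  \<open>k\<close> whose complement \<open>k'\<close> is monotone too. The Stieltjes measure of
  \<open>k\<close> then has a Radon-Nikodym density, and Lebesgue differentiation recovers the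
  density as a derivative almost everywhere.\<close>

lemma lipschitz_right_derivative:
  fixes h :: "real \<Rightarrow> real"
  assumes "L-lipschitz_on UNIV h"
  obtains g where "\<And>a b. a \<le> b \<Longrightarrow> (g has_integral (h b - h a)) {a..b}"
    and "AE t in lborel. ((\<lambda>s. (h (t + s) - h t) / s) \<longlongrightarrow> g t) (at_right 0)"
proof -
  \<comment> \<open>The Lipschitz constant may be 0; the maximum allows division by
    \<open>K\<close>.\<close>
  define K where "K = max L 1"
  have K: "K > 0" and lip: "K-lipschitz_on UNIV h"
    using lipschitz_on_le[OF assms] by (auto simp: K_def)
  have cont: "continuous_on UNIV h" using lip by (rule lipschitz_on_continuous_on)
  define k k' where "k = (\<lambda>t. (h t / K + t) / 2)" and "k' = (\<lambda>t. (t - h t / K) / 2)"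
  have bd: "\<bar>h y / K - h x / K\<bar> \<le> y - x" if "x \<le> y" for x y
    using lipschitz_onD[OF lip, of y x] that K by (simp add: dist_real_def field_simps flip: diff_divide_distrib)
  have mono: "mono k" "mono k'"
    using bd unfolding mono_def k_def k'_def by (smt (verit) divide_right_mono)+
  have ck: "continuous_on UNIV k" "continuous_on UNIV k'"
    unfolding k_def k'_def using K by (intro continuous_intros cont; simp)+
  have kk: "k t + k' t = t" for t by (simp add: k_def k'_def field_simps)
  let ?M = "interval_measure k"
  have rc: "continuous (at_right a) k" for a
    using ck(1) continuous_on_imp_continuous_within continuous_within_subset by blast
  have m: "\<And>x y. x \<le> y \<Longrightarrow> k x \<le> k y" using mono(1) by (rule monoD)
  have ac: "absolutely_continuous lborel ?M"
    unfolding absolutely_continuous_def null_sets_def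
    using lborel_eq_sum_interval_measures[OF mono ck kk] by (auto simp: sets_lborel)
  have sf: "sigma_finite_measure ?M" by (rule sigma_finite_interval_measure[OF m rc])
  define \<rho> where "\<rho> = (\<lambda>x. enn2real (RN_deriv lborel ?M x))"
  have [measurable]: "\<rho> \<in> borel_measurable borel" unfolding \<rho>_def by measurable
  have \<rho>AE: "AE x in lborel. RN_deriv lborel ?M x = ennreal (\<rho> x)"
    using sigma_finite_measure.RN_deriv_finite[OF sigma_finite_lborel sf ac]
    by (auto simp: \<rho>_def less_top)
  have int: "(\<rho> has_integral (k b - k a)) {a..b}" if "a \<le> b" for a b
  proof -
    have "(\<integral>\<^sup>+x. ennreal (\<rho> x * indicator {a..b} x) \<partial>lborel)
        = (\<integral>\<^sup>+x. RN_deriv lborel ?M x * indicator {a..b} x \<partial>lborel)"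
      by (rule nn_integral_cong_AE) (use \<rho>AE in \<open>auto split: split_indicator\<close>)
    also have "\<dots> = emeasure ?M {a..b}"
      by (metis ac sigma_finite_measure.density_RN_deriv[OF sigma_finite_lborel] emeasure_density
          borel_measurable_RN_deriv sets_interval_measure sets_lborel atLeastAtMost_borel)
    also have "\<dots> = ennreal (k b - k a)"
      using emeasure_interval_measure_Icc[OF that m ck(1)] by simp
    finally have "((\<lambda>x. \<rho> x * indicator {a..b} x) has_integral (k b - k a)) UNIV"
      using m[OF that] by (intro nn_integral_has_integral) (auto simp: \<rho>_def)
    then have "((\<lambda>x. if x \<in> {a..b} then \<rho> x else 0) has_integral (k b - k a)) UNIV"
      by (rule has_integral_eq[rotated]) auto
    then show ?thesis by (simp only: has_integral_restrict_UNIV)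
  qed
  \<comment> \<open>The differentiation theorem in use averages over boxes with lower corner
    \<open>x\<close>, hence the derivative obtained is one-sided.\<close>
  have "\<rho> integrable_on cbox a b" for a b
    using int[of a b] by (cases "a \<le> b") (auto simp: has_integral_integrable)
  then obtain N where N: "negligible N"
    and Ne: "\<And>x e. \<lbrakk>x \<notin> N; 0 < e\<rbrakk> \<Longrightarrow> \<exists>d>0. \<forall>s. 0 < s \<and> s < d \<longrightarrow>
        norm (integral (cbox x (x + s *\<^sub>R One)) \<rho> /\<^sub>R s ^ DIM(real) - \<rho> x) < e"
    using integrable_ccontinuous_explicit[of \<rho>] by blast
  have "((\<lambda>s. (h (t + s) - h t) / s) \<longlongrightarrow> K * (2 * \<rho> t - 1)) (at_right 0)" if "t \<notin> N" for t
  proof -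
    have "((\<lambda>s. (k (t + s) - k t) / s) \<longlongrightarrow> \<rho> t) (at_right 0)"
    proof (rule tendstoI)
      fix e :: real assume "0 < e"
      from Ne[OF that this] obtain d where d: "d > 0"
        "\<And>s. 0 < s \<Longrightarrow> s < d \<Longrightarrow> norm (integral (cbox t (t + s *\<^sub>R One)) \<rho> /\<^sub>R s ^ DIM(real) - \<rho> t) < e"
        by blast
      have "dist ((k (t + s) - k t) / s) (\<rho> t) < e" if "0 < s" "s < d" for s
        using d(2)[OF that] integral_unique[OF int[of t "t + s"]] that
        by (simp add: dist_real_def divide_inverse mult.commute)
      then show "\<forall>\<^sub>F s in at_right 0. dist ((k (t + s) - k t) / s) (\<rho> t) < e"
        unfolding eventually_at_right_field using d(1) by (auto intro!: exI[of _ d])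
    qed
    then have lim: "((\<lambda>s. K * (2 * ((k (t + s) - k t) / s) - 1)) \<longlongrightarrow> K * (2 * \<rho> t - 1)) (at_right 0)"
      by (intro tendsto_intros)
    have "K * (2 * ((k (t + s) - k t) / s) - 1) = (h (t + s) - h t) / s" if "s > 0" for s
      using that K by (simp add: k_def field_simps)
    then have "\<forall>\<^sub>F s in at_right 0. K * (2 * ((k (t + s) - k t) / s) - 1) = (h (t + s) - h t) / s"
      by (auto simp: eventually_at_right_field intro!: exI[of _ 1])
    with lim show ?thesis by (rule Lim_transform_eventually)
  qed
  with AE_lborel_not_in_negligible[OF N]
  have "AE t in lborel. ((\<lambda>s. (h (t + s) - h t) / s) \<longlongrightarrow> K * (2 * \<rho> t - 1)) (at_right 0)"
    by (auto elim!: eventually_mono)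
  moreover have "((\<lambda>t. K * (2 * \<rho> t - 1)) has_integral (h b - h a)) {a..b}" if "a \<le> b" for a b
  proof -
    have "((\<lambda>t. K * (2 * \<rho> t - 1)) has_integral K * (2 * (k b - k a) - (b - a))) {a..b}"
      using has_integral_const_real[of "1::real" a b] that
      by (intro has_integral_mult_right has_integral_diff int) auto
    moreover have "K * (2 * (k b - k a) - (b - a)) = h b - h a"
      using K by (simp add: k_def field_simps)
    ultimately show ?thesis by simp
  qed
  ultimately show thesis by (rule that[rotated])
qed

lemma AE_lborel_null_set:
  assumes "AE x in lborel. P (x::'a::euclidean_space)"
  obtains N where "N \<in> null_sets lborel" "\<And>x. x \<notin> N \<Longrightarrow> P x"
proof (rule AE_E3[OF assms])
  fix N assume "N \<in> null_sets lborel" "\<And>x. x \<in> space lborel - N \<Longrightarrow> P x"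
  then show thesis by (intro that[of N]) auto
qed

lemma AE_lborel_negligible:
  assumes "AE x in lborel. P (x::'a::euclidean_space)"
  shows "negligible {x. \<not> P x}"
proof -
  obtain N where N: "N \<in> null_sets lborel" "\<And>x. x \<notin> N \<Longrightarrow> P x" using AE_lborel_null_set[OF assms] by blast
  have "negligible N" using N(1) by (simp add: negligible_iff_null_sets null_sets_completionI)
  then show ?thesis by (rule negligible_subset) (use N(2) in blast)
qed

lemma lipschitz_increment_le:
  fixes h :: "real \<Rightarrow> real"
  assumes lip: "L-lipschitz_on UNIV h" and "a \<le> b"
    and bd: "AE t in lborel. t \<in> {a..b} \<longrightarrow> (\<exists>l\<le>M. ((\<lambda>s. (h (t + s) - h t) / s) \<longlongrightarrow> l) (at_right 0))"
  shows "h b - h a \<le> M * (b - a)"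
proof -
  obtain g where int: "\<And>a b. a \<le> b \<Longrightarrow> (g has_integral (h b - h a)) {a..b}"
    and lim: "AE t in lborel. ((\<lambda>s. (h (t + s) - h t) / s) \<longlongrightarrow> g t) (at_right 0)"
    using lipschitz_right_derivative[OF lip] by blast
  note g = int[OF \<open>a \<le> b\<close>]
  have "AE t in lborel. t \<in> {a..b} \<longrightarrow> g t \<le> M"
    using bd lim
  proof eventually_elim
    case (elim t)
    then show ?case using tendsto_unique[OF trivial_limit_at_right_real _ elim(2)] by blast
  qed
  then have N: "negligible {t. \<not> (t \<in> {a..b} \<longrightarrow> g t \<le> M)}" by (rule AE_lborel_negligible)
  \<comment> \<open>Truncation at \<open>M\<close> changes the integrand only on a null set and
    makes the upper bound hold at every point.\<close>
  have "((\<lambda>t. min (g t) M) has_integral (h b - h a)) {a..b}"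
    by (rule has_integral_spike[OF N _ g]) auto
  moreover have "((\<lambda>t. M) has_integral M * (b - a)) {a..b}"
    using has_integral_const_real[of M a b] \<open>a \<le> b\<close> by (simp add: mult.commute)
  ultimately show ?thesis by (rule has_integral_le) auto
qed

section \<open>Directional derivatives almost everywhere\<close>

definition right_dir_quot :: "('a::euclidean_space \<Rightarrow> real) \<Rightarrow> 'a \<Rightarrow> real \<Rightarrow> 'a \<Rightarrow> real" where
  "right_dir_quot h v s x = (h (x + s *\<^sub>R v) - h x) / s"

lemma right_dir_quot_bound:
  assumes "L-lipschitz_on UNIV h" "s > 0"
  shows "\<bar>right_dir_quot h v s x\<bar> \<le> L * norm v"
  using lipschitz_onD[OF assms(1), of "x + s *\<^sub>R v" x] assms(2)
  by (simp add: right_dir_quot_def dist_norm field_simps)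

lemma continuous_right_dir_quot:
  assumes "L-lipschitz_on UNIV h"
  shows "continuous_on UNIV (right_dir_quot h v s)"
  unfolding right_dir_quot_def divide_inverse
  by (intro continuous_intros continuous_on_compose2[OF lipschitz_on_continuous_on[OF assms]]) auto

text \<open>The Cauchy criterion with tolerances and radii of the form 1/(n+1) and non-strict
  inequalities. For quotients that are continuous in the base point it describes existence of the
  limit by countable unions and intersections of closed sets, so the exceptional set is
  Borel.\<close>

lemma right_limit_exists_iff:
  fixes q :: "real \<Rightarrow> real"
  shows "(\<exists>l. (q \<longlongrightarrow> l) (at_right 0)) \<longleftrightarrow>
    (\<forall>m::nat. \<exists>n::nat. \<forall>s\<in>{0<..<1 / Suc n}. \<forall>s'\<in>{0<..<1 / Suc n}. \<bar>q s - q s'\<bar> \<le> 1 / Suc m)"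
    (is "?L \<longleftrightarrow> ?R")
proof
  assume ?L
  then obtain l where l: "(q \<longlongrightarrow> l) (at_right 0)" by blast
  show ?R
  proof
    fix m :: nat
    from l have "\<forall>\<^sub>F s in at_right 0. dist (q s) l < 1 / (2 * Suc m)" by (rule tendstoD) simp
    then obtain d where d: "d > 0" "\<And>s. 0 < s \<Longrightarrow> s < d \<Longrightarrow> dist (q s) l < 1 / (2 * Suc m)"
      unfolding eventually_at_right_field by auto
    obtain n where n: "1 / real (Suc n) < d" using nat_approx_posE d(1) by blast
    have "\<bar>q s - q s'\<bar> \<le> 1 / Suc m" if "s\<in>{0<..<1 / Suc n}" "s'\<in>{0<..<1 / Suc n}" for s s'
    proof -
      have "dist (q s) l < 1 / (2 * Suc m)" "dist (q s') l < 1 / (2 * Suc m)" 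
        using that n d(2)[of s] d(2)[of s'] by (auto simp del: of_nat_Suc)
      moreover have "1 / (2 * real (Suc m)) + 1 / (2 * real (Suc m)) = 1 / real (Suc m)" by (simp add: field_simps)
      ultimately show ?thesis by (simp add: dist_real_def)
    qed
    then show "\<exists>n::nat. \<forall>s\<in>{0<..<1 / Suc n}. \<forall>s'\<in>{0<..<1 / Suc n}. \<bar>q s - q s'\<bar> \<le> 1 / Suc m" by blast
  qed
next
  assume R: ?R
  have "\<exists>P. eventually P (at_right 0) \<and> (\<forall>s s'. P s \<and> P s' \<longrightarrow> dist (q s) (q s') < e)" if "e > 0" for e
  proof -
    obtain m where m: "1 / real (Suc m) < e" using nat_approx_posE \<open>e > 0\<close> by blast
    obtain n where n: "\<forall>s\<in>{0<..<1 / real (Suc n)}. \<forall>s'\<in>{0<..<1 / real (Suc n)}. \<bar>q s - q s'\<bar> \<le> 1 / Suc m"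
      using R by blast
    have "eventually (\<lambda>s. s \<in> {0<..<1 / real (Suc n)}) (at_right 0)"
      by (rule eventually_at_right_real) simp
    then show ?thesis using n m
      unfolding dist_real_def by (meson le_less_trans)
  qed
  then have "cauchy_filter (filtermap q (at_right 0))"
    unfolding cauchy_filter_metric_filtermap by auto
  then have "\<exists>l. filtermap q (at_right 0) \<le> nhds l"
    by (rule cauchy_filter_complete_converges[OF _ complete_UNIV]) (simp_all add: filtermap_bot_iff)
  then show ?L
    by (simp add: filterlim_def)
qed

text \<open>Translation invariance gives every shift of \<open>N\<close> along \<open>v\<close> the
  same measure; averaging over \<open>t\<close> and exchanging the integrals expresses this measure
  through segments parallel to \<open>v\<close>. Null sets can thus be tested on such segments, and
  conversely.\<close>

lemma emeasure_lborel_eq_line_integral: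
  fixes N :: "'a::euclidean_space set"
  assumes N[measurable]: "N \<in> sets borel"
  shows "emeasure lborel N
    = (\<integral>\<^sup>+x. \<integral>\<^sup>+t. indicator {0..1::real} t * indicator N (x + t *\<^sub>R v) \<partial>lborel \<partial>lborel)"
proof -
  have shift: "(\<integral>\<^sup>+x. indicator N (x + c) \<partial>lborel) = emeasure lborel N" for c :: 'a
  proof -
    have "emeasure lborel N = (\<integral>\<^sup>+x. indicator N x \<partial>(distr lborel borel ((+) c)))"
      by (simp add: lborel_distr_plus)
    also have "\<dots> = (\<integral>\<^sup>+x. indicator N (c + x) \<partial>lborel)"
      by (rule nn_integral_distr) auto
    finally show ?thesis by (simp add: add.commute)
  qed
  have "emeasure lborel N = (\<integral>\<^sup>+t. indicator {0..1::real} t * emeasure lborel N \<partial>lborel)"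
    by (simp add: nn_integral_multc)
  also have "\<dots> = (\<integral>\<^sup>+t. \<integral>\<^sup>+x. indicator {0..1::real} t * indicator N (x + t *\<^sub>R v) \<partial>lborel \<partial>lborel)"
    by (simp add: nn_integral_cmult shift)
  also have "\<dots> = (\<integral>\<^sup>+x. \<integral>\<^sup>+t. indicator {0..1::real} t * indicator N (x + t *\<^sub>R v) \<partial>lborel \<partial>lborel)"
    by (rule lborel_pair.Fubini') measurable
  finally show ?thesis .
qed

text \<open>On each line parallel to \<open>v\<close> the one-dimensional result makes the
  exceptional set null. As this set is Borel, integration along lines makes it null in the whole
  space.\<close>

lemma AE_right_dir_derivative:
  fixes h :: "'a::euclidean_space \<Rightarrow> real"
  assumes lip: "L-lipschitz_on UNIV h"
  shows "AE x in lborel. \<exists>l. ((\<lambda>s. right_dir_quot h v s x) \<longlongrightarrow> l) (at_right 0)"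
proof -
  define N where "N = {x. \<not> (\<exists>l. ((\<lambda>s. right_dir_quot h v s x) \<longlongrightarrow> l) (at_right 0))}"
  define C where "C = (\<lambda>m n. {x. \<forall>s\<in>{0<..<1 / real (Suc n)}. \<forall>s'\<in>{0<..<1 / real (Suc n)}.
      \<bar>right_dir_quot h v s x - right_dir_quot h v s' x\<bar> \<le> 1 / real (Suc m)})"
  have "closed (C m n)" for m n
    unfolding C_def Ball_def
    by (intro closed_Collect_all closed_Collect_imp closed_Collect_le open_Collect_const
        continuous_intros continuous_right_dir_quot[OF lip])
  then have "C m n \<in> sets borel" for m n by (rule borel_closed)
  moreover have "N = UNIV - (\<Inter>m. \<Union>n. C m n)"
    unfolding N_def C_def right_limit_exists_iff by blast
  ultimately have N[measurable]: "N \<in> sets borel" by simp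
  have line: "(\<integral>\<^sup>+t. indicator {0..1::real} t * indicator N (x + t *\<^sub>R v) \<partial>lborel) = 0" for x
  proof -
    have "(L * norm v)-lipschitz_on UNIV (\<lambda>t. h (x + t *\<^sub>R v))"
    proof (rule lipschitz_onI)
      fix t t' :: real
      show "dist (h (x + t *\<^sub>R v)) (h (x + t' *\<^sub>R v)) \<le> L * norm v * dist t t'"
        using lipschitz_onD[OF lip, of "x + t *\<^sub>R v" "x + t' *\<^sub>R v"]
        by (simp add: dist_norm mult_ac flip: scaleR_diff_left)
    qed (use lipschitz_on_nonneg[OF lip] in simp)
    then obtain g where "AE t in lborel. ((\<lambda>s. (h (x + (t + s) *\<^sub>R v) - h (x + t *\<^sub>R v)) / s) \<longlongrightarrow> g t) (at_right 0)"
      using lipschitz_right_derivative by blast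
    then have "AE t in lborel. x + t *\<^sub>R v \<notin> N"
      by (auto elim!: eventually_mono simp: N_def right_dir_quot_def scaleR_add_left add.assoc)
    then have "AE t in lborel. indicator {0..1::real} t * indicator N (x + t *\<^sub>R v) = (0::ennreal)" by auto
    from nn_integral_cong_AE[OF this] show ?thesis by simp
  qed
  have "emeasure lborel N = 0"
    by (subst emeasure_lborel_eq_line_integral[OF N, of v]) (simp add: line)
  then have "N \<in> null_sets lborel" using N by (simp add: null_setsI)
  from AE_not_in[OF this] show ?thesis by (simp add: N_def)
qed
text \<open>The segment from \<open>x\<close> to \<open>y\<close> may lie inside the exceptional
  null set, so the derivative bound cannot be integrated along it. By Fubini almost every nearby
  parallel segment meets that set in a null set only, and continuity of \<open>p\<close> carries the
  estimate back.\<close>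

lemma lipschitz_of_AE_dir_derivative_bound:
  fixes p :: "'a::euclidean_space \<Rightarrow> 'b::euclidean_space"
  assumes lip: "L-lipschitz_on UNIV p" and G: "open G" "convex G" and c: "c \<ge> 0"
    and bd: "AE x in lborel. x \<in> G \<longrightarrow>
      (\<forall>v. \<exists>l. ((\<lambda>s. (p (x + s *\<^sub>R v) - p x) /\<^sub>R s) \<longlongrightarrow> l) (at_right 0) \<and> norm l \<le> c * norm v)"
  shows "c-lipschitz_on G p"
proof (rule lipschitz_onI[OF _ c])
  fix y x assume xy: "y \<in> G" "x \<in> G"
  define w where "w = y - x"
  \<comment> \<open>The inner product of \<open>p y - p x\<close> with \<open>e\<close> is its norm,
    so a scalar function along the segment suffices.\<close>
  define e where "e = sgn (p y - p x)"
  have ne: "norm e \<le> 1" by (simp add: e_def norm_sgn)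
  obtain r where r: "r > 0" "ball x r \<subseteq> G" "ball y r \<subseteq> G"
  proof -
    obtain r1 r2 where "r1 > 0" "ball x r1 \<subseteq> G" "r2 > 0" "ball y r2 \<subseteq> G"
      using G(1) xy open_contains_ball by metis
    then show thesis by (intro that[of "min r1 r2"]) auto
  qed
  have tube: "z + t *\<^sub>R w \<in> G" if "z \<in> ball x r" "t \<in> {0..1}" for z t
  proof -
    have "z + w \<in> ball y r" using that by (simp add: w_def dist_norm algebra_simps)
    then have "(1 - t) *\<^sub>R z + t *\<^sub>R (z + w) \<in> G"
      using r that by (intro convexD_alt[OF G(2)]) auto
    then show ?thesis by (simp add: algebra_simps)
  qed
  obtain N where N: "N \<in> null_sets lborel"
    "\<And>x. x \<notin> N \<Longrightarrow> x \<in> G \<longrightarrow>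
      (\<forall>v. \<exists>l. ((\<lambda>s. (p (x + s *\<^sub>R v) - p x) /\<^sub>R s) \<longlongrightarrow> l) (at_right 0) \<and> norm l \<le> c * norm v)"
    by (rule AE_lborel_null_set[OF bd]) (rule that)
  have Nb[measurable]: "N \<in> sets borel" using N(1) by auto
  have "(\<integral>\<^sup>+z. \<integral>\<^sup>+t. indicator {0..1::real} t * indicator N (z + t *\<^sub>R w) \<partial>lborel \<partial>lborel) = 0"
    using emeasure_lborel_eq_line_integral[OF Nb, of w] N(1) by auto
  then have "AE z in lborel. (\<integral>\<^sup>+t. indicator {0..1::real} t * indicator N (z + t *\<^sub>R w) \<partial>lborel) = 0"
    by (subst (asm) nn_integral_0_iff_AE) auto
  then have AEz: "AE z in lborel. AE t in lborel. t \<in> {0..1} \<longrightarrow> z + t *\<^sub>R w \<notin> N"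
  proof (rule eventually_mono)
    fix z assume "(\<integral>\<^sup>+t. indicator {0..1::real} t * indicator N (z + t *\<^sub>R w) \<partial>lborel) = 0"
    moreover have "(\<lambda>t. indicator {0..1::real} t * indicator N (z + t *\<^sub>R w) :: ennreal) \<in> borel_measurable lborel"
      by measurable
    ultimately have "AE t in lborel. indicator {0..1::real} t * indicator N (z + t *\<^sub>R w) = (0::ennreal)"
      using nn_integral_0_iff_AE by blast
    then show "AE t in lborel. t \<in> {0..1} \<longrightarrow> z + t *\<^sub>R w \<notin> N"
      by (rule eventually_mono) (auto simp: indicator_def split: if_splits)
  qed
  have inc: "(p (z + w) - p z) \<bullet> e \<le> c * norm w"
    if z: "z \<in> ball x r" and AEt: "AE t in lborel. t \<in> {0..1} \<longrightarrow> z + t *\<^sub>R w \<notin> N" for z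
  proof -
    define h where "h t = p (z + t *\<^sub>R w) \<bullet> e" for t :: real
    have hl: "(L * norm w)-lipschitz_on UNIV h"
    proof (rule lipschitz_onI)
      fix t t' :: real
      have "dist (h t) (h t') \<le> norm (p (z + t *\<^sub>R w) - p (z + t' *\<^sub>R w)) * norm e"
        unfolding h_def dist_real_def inner_diff_left[symmetric] by (rule Cauchy_Schwarz_ineq2)
      also have "\<dots> \<le> dist (p (z + t *\<^sub>R w)) (p (z + t' *\<^sub>R w)) * 1"
        using ne by (intro mult_mono) (auto simp: dist_norm)
      also have "\<dots> \<le> L * norm w * dist t t'"
        using lipschitz_onD[OF lip, of "z + t *\<^sub>R w" "z + t' *\<^sub>R w"]
        by (simp add: dist_norm mult_ac flip: scaleR_diff_left)
      finally show "dist (h t) (h t') \<le> L * norm w * dist t t'" .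
    qed (use lipschitz_on_nonneg[OF lip] in simp)
    have "AE t in lborel. t \<in> {0..1} \<longrightarrow>
        (\<exists>l\<le>c * norm w. ((\<lambda>s. (h (t + s) - h t) / s) \<longlongrightarrow> l) (at_right 0))"
      using AEt
    proof (rule eventually_mono, intro impI)
      fix t assume t: "t \<in> {0..1} \<longrightarrow> z + t *\<^sub>R w \<notin> N" "t \<in> {0..1}"
      then obtain l where l: "((\<lambda>s. (p (z + t *\<^sub>R w + s *\<^sub>R w) - p (z + t *\<^sub>R w)) /\<^sub>R s) \<longlongrightarrow> l) (at_right 0)"
        "norm l \<le> c * norm w"
        using N(2) tube[OF z t(2)] by blast
      have "l \<bullet> e \<le> norm l * norm e" by (rule norm_cauchy_schwarz)
      also have "\<dots> \<le> norm l" using ne by (simp add: mult_left_le)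
      finally have "l \<bullet> e \<le> c * norm w" using l(2) by simp
      moreover have "((\<lambda>s. (h (t + s) - h t) / s) \<longlongrightarrow> l \<bullet> e) (at_right 0)"
        using tendsto_inner[OF l(1) tendsto_const[of e]]
        by (simp add: h_def scaleR_add_left add.assoc inner_diff_left divide_inverse mult.commute)
      ultimately show "\<exists>l\<le>c * norm w. ((\<lambda>s. (h (t + s) - h t) / s) \<longlongrightarrow> l) (at_right 0)" by blast
    qed
    from lipschitz_increment_le[OF hl _ this] show ?thesis by (simp add: h_def inner_diff_left)
  qed
  have "(p (x + w) - p x) \<bullet> e \<le> c * norm w"
  proof (rule ccontr)
    assume neg: "\<not> (p (x + w) - p x) \<bullet> e \<le> c * norm w"
    \<comment> \<open>The base points near \<open>x\<close> that violate the estimate form an open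
      set, which is contained in a null set and is therefore empty.\<close>
    define U where "U = ball x r \<inter> {z. (p (z + w) - p z) \<bullet> e > c * norm w}"
    have cp: "continuous_on UNIV p" using lip by (rule lipschitz_on_continuous_on)
    have "open U" unfolding U_def
      by (intro open_Int open_ball open_Collect_less continuous_intros cp continuous_on_compose2[OF cp]) auto
    moreover have "x \<in> U" using neg r(1) by (simp add: U_def)
    moreover have "U \<subseteq> {z. \<not> (AE t in lborel. t \<in> {0..1} \<longrightarrow> z + t *\<^sub>R w \<notin> N)}"
    proof
      fix z assume "z \<in> U"
      then show "z \<in> {z. \<not> (AE t in lborel. t \<in> {0..1} \<longrightarrow> z + t *\<^sub>R w \<notin> N)}"
        using inc[of z] by (auto simp only: U_def Int_iff mem_Collect_eq not_le[symmetric])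
    qed
    then have "negligible U"
      by (rule negligible_subset[OF AE_lborel_negligible[OF AEz]])
    ultimately show False using open_not_negligible[of U] by blast
  qed
  moreover have "(p (x + w) - p x) \<bullet> e = norm (p y - p x)"
    by (cases "p y = p x") (simp_all add: w_def e_def sgn_div_norm power2_norm_eq_inner[symmetric] power2_eq_square)
  ultimately show "dist (p y) (p x) \<le> c * dist y x" by (simp add: dist_norm w_def)
qed

section \<open>Linearity of the directional derivative\<close>

text \<open>Taking the limit along the sequence 1/(n+1) makes the function total and Borel
  measurable. Where the one-sided derivative exists, this is its value.\<close>

definition right_dir_deriv :: "('a::euclidean_space \<Rightarrow> real) \<Rightarrow> 'a \<Rightarrow> 'a \<Rightarrow> real" where
  "right_dir_deriv h v x = lim (\<lambda>n. right_dir_quot h v (1 / real (Suc n)) x)"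

lemma tendsto_right_dir_derivI:
  assumes "((\<lambda>s. right_dir_quot h v s x) \<longlongrightarrow> l) (at_right 0)"
  shows "right_dir_deriv h v x = l"
proof -
  have "filterlim (\<lambda>n. 1 / real (Suc n)) (at_right 0) sequentially"
    by (intro tendsto_imp_filterlim_at_right LIMSEQ_Suc[OF lim_const_over_n]) simp
  from filterlim_compose[OF assms this] show ?thesis
    unfolding right_dir_deriv_def by (rule limI)
qed

lemma AE_right_dir_deriv:
  assumes "L-lipschitz_on UNIV h"
  shows "AE x in lborel. ((\<lambda>s. right_dir_quot h v s x) \<longlongrightarrow> right_dir_deriv h v x) (at_right 0)"
  using AE_right_dir_derivative[OF assms, of v] tendsto_right_dir_derivI[of h v]
  by (auto elim!: eventually_mono)

lemma AE_right_dir_deriv_seq: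
  assumes "L-lipschitz_on UNIV h"
  shows "AE x in lborel. (\<lambda>n. right_dir_quot h v (1 / real (Suc n)) x) \<longlonglongrightarrow> right_dir_deriv h v x"
proof -
  have "filterlim (\<lambda>n. 1 / real (Suc n)) (at_right 0) sequentially"
    by (intro tendsto_imp_filterlim_at_right LIMSEQ_Suc[OF lim_const_over_n]) simp
  with AE_right_dir_deriv[OF assms, of v] show ?thesis
    by (auto elim!: eventually_mono intro: filterlim_compose)
qed

lemma borel_measurable_right_dir_quot:
  assumes "L-lipschitz_on UNIV h"
  shows "right_dir_quot h v s \<in> borel_measurable borel"
  by (rule borel_measurable_continuous_onI[OF continuous_right_dir_quot[OF assms]])

lemma borel_measurable_right_dir_deriv:
  assumes "L-lipschitz_on UNIV h"
  shows "right_dir_deriv h v \<in> borel_measurable borel"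
  unfolding right_dir_deriv_def[abs_def]
  by (intro borel_measurable_lim_metric borel_measurable_right_dir_quot[OF assms])

lemma indicator_cbox_shift_tendsto:
  fixes a b x :: "'a::euclidean_space"
  assumes "x \<notin> cbox a b - box a b" "c \<longlonglongrightarrow> 0"
  shows "(\<lambda>n. indicator (cbox a b) (x - c n) :: real) \<longlonglongrightarrow> indicator (cbox a b) x"
proof -
  have lim: "(\<lambda>n. x - c n) \<longlonglongrightarrow> x"
    using tendsto_diff[OF tendsto_const assms(2)] by simp
  consider "x \<in> box a b" | "x \<in> - cbox a b" using assms(1) by auto
  then have "\<forall>\<^sub>F n in sequentially. indicator (cbox a b) (x - c n) = (indicator (cbox a b) x :: real)"
  proof cases
    case 1
    from topological_tendstoD[OF lim open_box this] show ?thesis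
      using 1 box_subset_cbox[of a b] by (auto elim!: eventually_mono simp: indicator_def)
  next
    case 2
    from topological_tendstoD[OF lim _ this] show ?thesis
      using 2 by (auto elim!: eventually_mono simp: indicator_def open_Compl)
  qed
  then show ?thesis by (rule tendsto_eventually)
qed

text \<open>The shift of the argument by \<open>c n\<close> is moved onto the box, whose indicator then converges
  off the frontier.\<close>

lemma integral_shifted_right_dir_quot:
  fixes h :: "'a::euclidean_space \<Rightarrow> real" and a b v :: 'a
  assumes lip: "L-lipschitz_on UNIV h" and c: "c \<longlonglongrightarrow> 0"
  defines "q \<equiv> \<lambda>n. right_dir_quot h v (1 / real (Suc n))"
  shows "integrable lborel (\<lambda>x. indicator (cbox a b) x * right_dir_deriv h v x)"
    and "integrable lborel (\<lambda>x. indicator (cbox a b) x * q n (x + c n))"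
    and "(\<lambda>n. \<integral>x. indicator (cbox a b) x * q n (x + c n) \<partial>lborel)
           \<longlonglongrightarrow> (\<integral>x. indicator (cbox a b) x * right_dir_deriv h v x \<partial>lborel)"
proof -
  obtain M where M: "\<And>n. norm (c n) \<le> M"
    using convergent_imp_Bseq[OF convergentI[OF c]] by (auto simp: Bseq_def)
  \<comment> \<open>The dominating function: quotients are bounded by \<open>L * norm v\<close>, and
    shifts of norm at most \<open>M\<close> keep the box inside one enlarged by \<open>M\<close> in
    each coordinate.\<close>
  define w where "w = (\<lambda>x::'a. L * norm v * indicator (cbox (a - M *\<^sub>R One) (b + M *\<^sub>R One)) x)"
  have L: "0 \<le> L * norm v" using lipschitz_on_nonneg[OF lip] by simp
  have [measurable]: "q n \<in> borel_measurable borel" for n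
    unfolding q_def by (rule borel_measurable_right_dir_quot[OF lip])
  have [measurable]: "right_dir_deriv h v \<in> borel_measurable borel"
    by (rule borel_measurable_right_dir_deriv[OF lip])
  have w: "integrable lborel w"
    unfolding w_def
    by (intro integrable_mult_right integrable_real_indicator emeasure_lborel_cbox_finite) auto
  have mem: "x \<in> cbox (a - M *\<^sub>R One) (b + M *\<^sub>R One)" if "x - c n \<in> cbox a b" for x n
  proof -
    have "\<bar>c n \<bullet> i\<bar> \<le> M" if "i \<in> Basis" for i
      using Basis_le_norm[OF that, of "c n"] M[of n] by linarith
    then show ?thesis using that unfolding mem_box by (force simp: inner_simps)
  qed
  have bound: "AE x in lborel. norm (indicator (cbox a b) (x - c n) * q n x) \<le> w x" for n
    using right_dir_quot_bound[OF lip, of "1 / real (Suc n)" v] mem L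
    by (auto simp: w_def q_def indicator_def)
  have neg: "AE x in lborel. x \<notin> cbox a b - box a b"
    by (rule AE_lborel_not_in_negligible[OF negligible_frontier_interval])
  have conv: "AE x in lborel. (\<lambda>n. indicator (cbox a b) (x - c n) * q n x)
      \<longlonglongrightarrow> indicator (cbox a b) x * right_dir_deriv h v x"
    using neg AE_right_dir_deriv_seq[OF lip, of v]
    by eventually_elim (auto simp: q_def intro!: tendsto_mult indicator_cbox_shift_tendsto c)
  show "integrable lborel (\<lambda>x. indicator (cbox a b) x * right_dir_deriv h v x)"
    by (rule integrable_dominated_convergence[OF _ _ w conv bound]) measurable
  have shift: "integrable lborel (\<lambda>x. F (x + s)) \<and> (\<integral>x. F (x + s) \<partial>lborel) = (\<integral>x. F x \<partial>lborel)"
    if "integrable lborel F" for F :: "'a \<Rightarrow> real" and s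
  proof -
    have [measurable]: "F \<in> borel_measurable borel" using that by simp
    show ?thesis
      using integrable_distr_eq[of "(+) s" lborel borel F] integral_distr[of "(+) s" lborel borel F] that
      by (simp add: lborel_distr_plus add.commute)
  qed
  have i: "integrable lborel (\<lambda>x. indicator (cbox a b) (x - c n) * q n x)" for n
    by (rule integrable_dominated_convergence2[OF _ _ w conv bound]) measurable
  show "integrable lborel (\<lambda>x. indicator (cbox a b) x * q n (x + c n))"
    using shift[OF i[of n], of "c n"] by simp
  have "(\<lambda>n. \<integral>x. indicator (cbox a b) (x - c n) * q n x \<partial>lborel)
           \<longlonglongrightarrow> (\<integral>x. indicator (cbox a b) x * right_dir_deriv h v x \<partial>lborel)"
    by (rule integral_dominated_convergence[OF _ _ w conv bound]) measurable
  moreover have "(\<integral>x. indicator (cbox a b) x * q n (x + c n) \<partial>lborel)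
      = (\<integral>x. indicator (cbox a b) (x - c n) * q n x \<partial>lborel)" for n
    using shift[OF i[of n], of "c n"] by simp
  ultimately show "(\<lambda>n. \<integral>x. indicator (cbox a b) x * q n (x + c n) \<partial>lborel)
           \<longlonglongrightarrow> (\<integral>x. indicator (cbox a b) x * right_dir_deriv h v x \<partial>lborel)"
    by simp
qed

text \<open>Almost everywhere the value is the limit of averages over shrinking boxes, all of which
  vanish.\<close>

lemma AE_zero_if_integral_cbox_zero:
  fixes f :: "'a::euclidean_space \<Rightarrow> real"
  assumes "\<And>a b. (f has_integral 0) (cbox a b)"
  shows "AE x in lborel. f x = 0"
proof -
  have "f integrable_on cbox a b" for a b using assms by (rule has_integral_integrable)
  then obtain N where N: "negligible N"
    and Ne: "\<And>x e. \<lbrakk>x \<notin> N; 0 < e\<rbrakk> \<Longrightarrow> \<exists>d>0. \<forall>s. 0 < s \<and> s < d \<longrightarrow>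
        norm (integral (cbox x (x + s *\<^sub>R One)) f /\<^sub>R s ^ DIM('a) - f x) < e"
    using integrable_ccontinuous_explicit[of f] by blast
  have "f x = 0" if "x \<notin> N" for x
  proof (rule ccontr)
    assume "f x \<noteq> 0"
    with Ne[OF that, of "\<bar>f x\<bar>"] obtain d where d: "d > 0"
      "\<forall>s. 0 < s \<and> s < d \<longrightarrow> norm (integral (cbox x (x + s *\<^sub>R One)) f /\<^sub>R s ^ DIM('a) - f x) < \<bar>f x\<bar>"
      by auto
    with spec[OF d(2), of "d/2"] integral_unique[OF assms] show False by simp
  qed
  with AE_lborel_not_in_negligible[OF N] show ?thesis by (auto elim!: eventually_mono)
qed

text \<open>The quotient in direction \<open>u + v\<close> at \<open>x\<close> is the quotient for
  \<open>v\<close> at a point shifted along \<open>u\<close> plus the quotient for \<open>u\<close>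
  at \<open>x\<close>. The shift obstructs a pointwise limit but disappears in the limit of
  integrals over a box, so the defect of additivity integrates to 0 over every box.\<close>

lemma AE_right_dir_deriv_add:
  fixes h :: "'a::euclidean_space \<Rightarrow> real"
  assumes lip: "L-lipschitz_on UNIV h"
  shows "AE x in lborel. right_dir_deriv h (u + v) x = right_dir_deriv h u x + right_dir_deriv h v x"
proof -
  define D where "D = (\<lambda>x. right_dir_deriv h (u + v) x - (right_dir_deriv h v x + right_dir_deriv h u x))"
  have "(D has_integral 0) (cbox a b)" for a b :: 'a
  proof -
    let ?I = "\<lambda>v c n. \<integral>x. indicator (cbox a b) x * right_dir_quot h v (1 / real (Suc n)) (x + c n) \<partial>lborel"
    let ?D = "\<lambda>v. \<integral>x. indicator (cbox a b) x * right_dir_deriv h v x \<partial>lborel"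
    define c where "c = (\<lambda>n. (1 / real (Suc n)) *\<^sub>R u)"
    have c: "c \<longlonglongrightarrow> 0"
      unfolding c_def using tendsto_scaleR[OF LIMSEQ_Suc[OF lim_const_over_n[of 1]] tendsto_const[of u]]
      by simp
    have z: "(\<lambda>n::nat. 0::'a) \<longlonglongrightarrow> 0" by simp
    note I = integral_shifted_right_dir_quot[OF lip, where a = a and b = b]
    have "?I (u + v) (\<lambda>n. 0) n = ?I v c n + ?I u (\<lambda>n. 0) n" for n
    proof -
      have "right_dir_quot h (u + v) s x = right_dir_quot h v s (x + s *\<^sub>R u) + right_dir_quot h u s x" for x s
        by (simp add: right_dir_quot_def scaleR_add_right add.assoc flip: add_divide_distrib)
      then show ?thesis
        using I(2)[OF c, of v n] I(2)[OF z, of u n]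
        by (subst Bochner_Integration.integral_add[symmetric]) (auto simp: c_def ring_distribs)
    qed
    then have "(\<lambda>n. ?I v c n + ?I u (\<lambda>n. 0) n) \<longlonglongrightarrow> ?D (u + v)"
      using I(3)[OF z, of "u + v"] by simp
    moreover have "(\<lambda>n. ?I v c n + ?I u (\<lambda>n. 0) n) \<longlonglongrightarrow> ?D v + ?D u"
      by (intro tendsto_add I(3) c z)
    ultimately have "?D (u + v) = ?D v + ?D u" by (rule LIMSEQ_unique)
    moreover have int: "integrable lborel (\<lambda>x. indicator (cbox a b) x * D x)"
      unfolding D_def right_diff_distrib distrib_left
      by (intro Bochner_Integration.integrable_diff Bochner_Integration.integrable_add I(1)[OF z])
    moreover have "(\<integral>x. indicator (cbox a b) x * D x \<partial>lborel) = ?D (u + v) - (?D v + ?D u)"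
      unfolding D_def right_diff_distrib distrib_left
      using I(1)[OF z] by (simp add: Bochner_Integration.integral_diff Bochner_Integration.integral_add)
    ultimately have "(\<integral>x. indicator (cbox a b) x * D x \<partial>lborel) = 0" by simp
    with has_integral_integral_lborel[OF int]
    have "((\<lambda>x. indicator (cbox a b) x * D x) has_integral 0) UNIV" by simp
    moreover have "(\<lambda>x. indicator (cbox a b) x * D x) = (\<lambda>x. if x \<in> cbox a b then D x else 0)" by auto
    ultimately have "((\<lambda>x. if x \<in> cbox a b then D x else 0) has_integral 0) UNIV" by simp
    then show ?thesis by (simp only: has_integral_restrict_UNIV)
  qed
  from AE_zero_if_integral_cbox_zero[OF this] show ?thesis by (auto simp: D_def elim!: eventually_mono)
qed

lemma right_dir_deriv_zero: "right_dir_deriv h 0 x = 0"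
  by (rule tendsto_right_dir_derivI) (simp add: right_dir_quot_def)

lemma AE_right_dir_deriv_scaleR:
  fixes h :: "'a::euclidean_space \<Rightarrow> real"
  assumes lip: "L-lipschitz_on UNIV h"
  shows "AE x in lborel. right_dir_deriv h (c *\<^sub>R v) x = c * right_dir_deriv h v x"
proof -
  have pos: "AE x in lborel. right_dir_deriv h (c *\<^sub>R v) x = c * right_dir_deriv h v x" if "c \<ge> 0" for c
  proof (cases "c = 0")
    case False
    with that have c: "c > 0" by simp
    have "right_dir_deriv h (c *\<^sub>R v) x = c * right_dir_deriv h v x"
      if x: "((\<lambda>s. right_dir_quot h v s x) \<longlongrightarrow> right_dir_deriv h v x) (at_right 0)" for x
    proof (rule tendsto_right_dir_derivI)
      have "((\<lambda>s. c * s) \<longlongrightarrow> c * 0) (at_right 0)" by (intro tendsto_intros)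
      then have "filterlim (\<lambda>s. c * s) (at_right 0) (at_right 0)"
        using c by (intro tendsto_imp_filterlim_at_right) (auto simp: eventually_at_right_field intro!: exI[of _ 1])
      from tendsto_mult[OF tendsto_const[of c] filterlim_compose[OF x this]]
      show "((\<lambda>s. right_dir_quot h (c *\<^sub>R v) s x) \<longlongrightarrow> c * right_dir_deriv h v x) (at_right 0)"
        using c by (simp add: right_dir_quot_def mult.commute)
    qed
    with AE_right_dir_deriv[OF lip, of v] show ?thesis by (auto elim!: eventually_mono)
  qed (simp add: right_dir_deriv_zero)
  show ?thesis
  proof (cases "c \<ge> 0")
    case False
    \<comment> \<open>For negative \<open>c\<close>, additivity applied to two vectors with sum 0
      reduces the claim to the positive factor \<open>-c\<close>.\<close>
    have "AE x in lborel. right_dir_deriv h (c *\<^sub>R v + (-c) *\<^sub>R v) x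
        = right_dir_deriv h (c *\<^sub>R v) x + right_dir_deriv h ((-c) *\<^sub>R v) x"
      by (rule AE_right_dir_deriv_add[OF lip])
    with pos[of "-c"] False show ?thesis
      by (auto simp: right_dir_deriv_zero)
  qed (rule pos)
qed

lemma AE_right_dir_deriv_eq_sum:
  fixes h :: "'a::euclidean_space \<Rightarrow> real"
  assumes lip: "L-lipschitz_on UNIV h"
  shows "AE x in lborel. right_dir_deriv h v x = (\<Sum>b\<in>Basis. (v \<bullet> b) * right_dir_deriv h b x)"
proof -
  have "AE x in lborel. right_dir_deriv h (\<Sum>b\<in>S. (v \<bullet> b) *\<^sub>R b) x = (\<Sum>b\<in>S. (v \<bullet> b) * right_dir_deriv h b x)"
    if "finite S" for S
    using that
  proof induction
    case (insert b S)
    from AE_right_dir_deriv_add[OF lip, of "(v \<bullet> b) *\<^sub>R b" "\<Sum>b\<in>S. (v \<bullet> b) *\<^sub>R b"]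
      AE_right_dir_deriv_scaleR[OF lip, of "v \<bullet> b" b] insert.IH
    show ?case by eventually_elim (simp add: insert.hyps)
  qed (simp add: right_dir_deriv_zero)
  from this[OF finite_Basis] show ?thesis by (simp add: euclidean_representation)
qed

text \<open>Existence and linearity hold off a null set that depends on the direction. Countably
  many directions share one null set, and the Lipschitz bound, uniform in the step size, passes from
  a dense set of directions to all of them.\<close>

lemma rademacher_gateaux:
  fixes p :: "'a::euclidean_space \<Rightarrow> 'b::euclidean_space"
  assumes lip: "L-lipschitz_on UNIV p"
  shows "AE x in lborel. \<exists>A. linear A \<and>
    (\<forall>v. ((\<lambda>s. (p (x + s *\<^sub>R v) - p x) /\<^sub>R s) \<longlongrightarrow> A v) (at_right 0))"
proof -
  obtain Q :: "'a set" where Q: "countable Q" "\<And>X. open X \<Longrightarrow> X \<noteq> {} \<Longrightarrow> \<exists>d\<in>Q. d \<in> X"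
    using countable_dense_exists by blast
  have L: "0 \<le> L" using lip by (rule lipschitz_on_nonneg)
  have lipi: "L-lipschitz_on UNIV (\<lambda>x. p x \<bullet> i)" if "i \<in> Basis" for i
  proof (rule lipschitz_onI[OF _ L])
    fix x y
    have "dist (p x \<bullet> i) (p y \<bullet> i) \<le> norm (p x - p y)"
      using Basis_le_norm[OF that, of "p x - p y"] by (simp add: dist_real_def inner_diff_left)
    also have "\<dots> \<le> L * dist x y" using lipschitz_onD[OF lip, of x y] by (simp add: dist_norm)
    finally show "dist (p x \<bullet> i) (p y \<bullet> i) \<le> L * dist x y" .
  qed
  let ?g = "\<lambda>x i v. \<Sum>b\<in>Basis. (v \<bullet> b) * right_dir_deriv (\<lambda>x. p x \<bullet> i) b x"
  have "AE x in lborel. \<forall>i\<in>Basis. \<forall>v\<in>Q. ((\<lambda>s. right_dir_quot (\<lambda>x. p x \<bullet> i) v s x) \<longlongrightarrow> ?g x i v) (at_right 0)"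
  proof (rule AE_finite_allI[OF finite_Basis], rule AE_ball_countable'[OF _ Q(1)])
    fix i :: 'b and v :: 'a assume i: "i \<in> Basis"
    from AE_right_dir_deriv[OF lipi[OF i], of v] AE_right_dir_deriv_eq_sum[OF lipi[OF i], of v]
    show "AE x in lborel. ((\<lambda>s. right_dir_quot (\<lambda>x. p x \<bullet> i) v s x) \<longlongrightarrow> ?g x i v) (at_right 0)"
      by eventually_elim simp
  qed
  then show ?thesis
  proof (rule eventually_mono)
    fix x assume x: "\<forall>i\<in>Basis. \<forall>v\<in>Q. ((\<lambda>s. right_dir_quot (\<lambda>x. p x \<bullet> i) v s x) \<longlongrightarrow> ?g x i v) (at_right 0)"
    define A where "A v = (\<Sum>i\<in>Basis. ?g x i v *\<^sub>R i)" for v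
    define q where "q v s = (p (x + s *\<^sub>R v) - p x) /\<^sub>R s" for v and s :: real
    have "A = (\<lambda>v. \<Sum>i\<in>Basis. (v \<bullet> (\<Sum>b\<in>Basis. right_dir_deriv (\<lambda>x. p x \<bullet> i) b x *\<^sub>R b)) *\<^sub>R i)"
      by (rule ext) (simp add: A_def inner_sum_right mult.commute)
    then have lin: "linear A"
      by (auto intro!: linearI simp: inner_add_left scaleR_add_left sum.distrib scaleR_sum_right)
    have AQ: "(q v \<longlongrightarrow> A v) (at_right 0)" if "v \<in> Q" for v
      unfolding A_def
    proof (rule tendsto_componentwise_iff[THEN iffD2], intro ballI)
      fix i :: 'b assume i: "i \<in> Basis"
      have "(\<lambda>s. q v s \<bullet> i) = (\<lambda>s. right_dir_quot (\<lambda>x. p x \<bullet> i) v s x)"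
        by (auto simp: q_def right_dir_quot_def inner_diff_left divide_inverse mult.commute)
      then show "((\<lambda>s. q v s \<bullet> i) \<longlongrightarrow> (\<Sum>i\<in>Basis. ?g x i v *\<^sub>R i) \<bullet> i) (at_right 0)"
        using x i that by simp
    qed
    have "(q v \<longlongrightarrow> A v) (at_right 0)" for v
    proof (rule tendstoI)
      fix e :: real assume e: "e > 0"
      \<comment> \<open>The directions \<open>u\<close> for which replacing \<open>v\<close> by
        \<open>u\<close> costs less than \<open>e / 2\<close> in the quotient and in the linear
        limit together.\<close>
      define X where "X = {u. L * norm (v - u) + norm (A (u - v)) < e / 2}"
      have "continuous_on UNIV (\<lambda>u. A (u - v))"
        by (intro linear_continuous_on_compose[OF _ lin] continuous_intros)
      then have "open X" unfolding X_def by (intro open_Collect_less continuous_intros)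
      moreover have "v \<in> X" using e linear_0[OF lin] by (simp add: X_def)
      ultimately obtain u where u: "u \<in> Q" "L * norm (v - u) + norm (A (u - v)) < e / 2"
        using Q(2)[of X] unfolding X_def by blast
      from tendstoD[OF AQ[OF u(1)], of "e/2"] e
      have ev: "\<forall>\<^sub>F s in at_right 0. dist (q u s) (A u) < e / 2" by simp
      have qq: "dist (q v s) (q u s) \<le> L * norm (v - u)" if "s > 0" for s
      proof -
        have "q v s - q u s = (p (x + s *\<^sub>R v) - p (x + s *\<^sub>R u)) /\<^sub>R s"
          unfolding q_def scaleR_diff_right[symmetric] by simp
        then have "dist (q v s) (q u s) = norm (p (x + s *\<^sub>R v) - p (x + s *\<^sub>R u)) / s"
          using that by (simp add: dist_norm divide_inverse mult.commute)
        also have "\<dots> \<le> L * (s * norm (v - u)) / s"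
          using lipschitz_onD[OF lip, of "x + s *\<^sub>R v" "x + s *\<^sub>R u"] that
          by (intro divide_right_mono) (simp_all add: dist_norm flip: scaleR_diff_right)
        finally show ?thesis using that by simp
      qed
      have "\<forall>\<^sub>F s in at_right (0::real). s > 0" by (simp add: eventually_at_right_less)
      with ev show "\<forall>\<^sub>F s in at_right 0. dist (q v s) (A v) < e"
      proof eventually_elim
        case (elim s)
        have "dist (q v s) (A v) \<le> dist (q v s) (q u s) + dist (q u s) (A u) + dist (A u) (A v)"
          by metric
        also have "dist (A u) (A v) = norm (A (u - v))" by (simp add: dist_norm linear_diff[OF lin])
        finally show ?case using qq[OF elim(2)] elim(1) u(2) by simp
      qed
    qed
    then show "\<exists>A. linear A \<and> (\<forall>v. ((\<lambda>s. (p (x + s *\<^sub>R v) - p x) /\<^sub>R s) \<longlongrightarrow> A v) (at_right 0))"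
      using lin unfolding q_def by blast
  qed
qed

section \<open>Quadratic growth by conjugacy\<close>

text \<open>The first-order error lies between 0, by the inequality at \<open>v\<close>, and the
  inner product of \<open>m w - m v\<close> with \<open>w - v\<close>, by the inequality at
  \<open>w\<close>. Continuity of \<open>m\<close> makes the upper bound of smaller order.\<close>

lemma has_derivative_of_subgradient:
  fixes H :: "'a::euclidean_space \<Rightarrow> real"
  assumes U: "open U" "v \<in> U" and cont: "continuous_on U m"
    and sub: "\<And>v w. v \<in> U \<Longrightarrow> w \<in> U \<Longrightarrow> H w \<ge> H v + m v \<bullet> (w - v)"
  shows "(H has_derivative (\<lambda>d. m v \<bullet> d)) (at v)"
  unfolding has_derivative_at_alt
proof (intro conjI allI impI)
  show "bounded_linear (\<lambda>d. m v \<bullet> d)" by (rule bounded_linear_inner_right)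
  fix e :: real assume e: "e > 0"
  have "isCont m v" using cont U by (simp add: continuous_on_eq_continuous_at)
  then obtain d1 where d1: "d1 > 0" "\<And>w. dist w v < d1 \<Longrightarrow> dist (m w) (m v) < e"
    using e unfolding continuous_at_eps_delta by blast
  obtain d2 where d2: "d2 > 0" "ball v d2 \<subseteq> U" using U open_contains_ball by blast
  have "norm (H w - H v - m v \<bullet> (w - v)) \<le> e * norm (w - v)" if w: "norm (w - v) < min d1 d2" for w
  proof -
    have wU: "w \<in> U" using w d2 by (auto simp: dist_norm norm_minus_commute)
    have "H w - H v - m v \<bullet> (w - v) \<le> (m w - m v) \<bullet> (w - v)"
      using sub[OF wU U(2)] by (simp add: inner_diff_left inner_diff_right)
    also have "\<dots> \<le> norm (m w - m v) * norm (w - v)" by (rule norm_cauchy_schwarz)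
    also have "\<dots> \<le> e * norm (w - v)"
      using d1(2)[of w] w by (intro mult_right_mono) (auto simp: dist_norm)
    finally show ?thesis using sub[OF U(2) wU] by simp
  qed
  then show "\<exists>d>0. \<forall>w. norm (w - v) < d \<longrightarrow> norm (H w - H v - m v \<bullet> (w - v)) \<le> e * norm (w - v)"
    using d1(1) d2(1) by (intro exI[of _ "min d1 d2"]) auto
qed

lemma has_real_derivative_along_line:
  fixes H :: "'a::euclidean_space \<Rightarrow> real"
  assumes "(H has_derivative (\<lambda>d. g \<bullet> d)) (at (v + s *\<^sub>R d))"
  shows "((\<lambda>s. H (v + s *\<^sub>R d)) has_real_derivative g \<bullet> d) (at s)"
proof -
  have line: "((\<lambda>s. v + s *\<^sub>R d) has_derivative (\<lambda>s. s *\<^sub>R d)) (at s)"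
    by (auto intro!: derivative_eq_intros)
  have eq: "(\<lambda>d. g \<bullet> d) \<circ> (\<lambda>s. s *\<^sub>R d) = (*) (g \<bullet> d)" by auto
  show ?thesis
    using diff_chain_at[OF line assms] unfolding has_field_derivative_def eq by (simp add: o_def)
qed

text \<open>The descent lemma. \<open>H\<close> is differentiable with gradient \<open>m\<close>,
  and the auxiliary function \<open>\<psi>\<close>, which subtracts the claimed bound along the
  segment, has nonpositive derivative.\<close>

lemma lipschitz_gradient_upper_bound:
  fixes H :: "'a::euclidean_space \<Rightarrow> real"
  assumes U: "open U" "convex U" "v \<in> U" "w \<in> U" and lip: "\<kappa>-lipschitz_on U m"
    and sub: "\<And>v w. v \<in> U \<Longrightarrow> w \<in> U \<Longrightarrow> H w \<ge> H v + m v \<bullet> (w - v)"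
  shows "H w \<le> H v + m v \<bullet> (w - v) + \<kappa> / 2 * (norm (w - v))\<^sup>2"
proof -
  define d where "d = w - v"
  have inU: "v + s *\<^sub>R d \<in> U" if "0 \<le> s" "s \<le> 1" for s
    using convexD_alt[OF U(2,3,4) that] by (simp add: d_def algebra_simps)
  define \<psi> where "\<psi> s = H (v + s *\<^sub>R d) - s * (m v \<bullet> d) - \<kappa> * s\<^sup>2 / 2 * (norm d)\<^sup>2" for s
  have "\<psi> 1 \<le> \<psi> 0"
  proof (rule DERIV_nonpos_imp_nonincreasing[where f = \<psi>])
    fix s :: real assume s: "0 \<le> s" "s \<le> 1"
    note line = has_real_derivative_along_line[OF
      has_derivative_of_subgradient[OF U(1) inU[OF s] lipschitz_on_continuous_on[OF lip] sub]]
    have "(\<psi> has_real_derivative m (v + s *\<^sub>R d) \<bullet> d - m v \<bullet> d - \<kappa> * s * (norm d)\<^sup>2) (at s)"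
      unfolding \<psi>_def
      by (rule derivative_eq_intros line refl | simp)+
    moreover have "m (v + s *\<^sub>R d) \<bullet> d - m v \<bullet> d \<le> \<kappa> * s * (norm d)\<^sup>2"
    proof -
      have "m (v + s *\<^sub>R d) \<bullet> d - m v \<bullet> d \<le> norm (m (v + s *\<^sub>R d) - m v) * norm d"
        unfolding inner_diff_left[symmetric] by (rule norm_cauchy_schwarz)
      also have "norm (m (v + s *\<^sub>R d) - m v) \<le> \<kappa> * (s * norm d)"
        using lipschitz_onD[OF lip inU[OF s] U(3)] s by (simp add: dist_norm)
      finally show ?thesis by (simp add: power2_eq_square mult_right_mono mult.assoc)
    qed
    ultimately show "\<exists>y. (\<psi> has_real_derivative y) (at s) \<and> y \<le> 0" by auto
  qed simp
  then show ?thesis by (simp add: \<psi>_def d_def)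
qed

text \<open>The function \<open>H v = v \<bullet> m v - \<Phi> (m v)\<close> is the conjugate of \<open>\<Phi>\<close> on \<open>S\<close>; the quadratic upper
  bound for \<open>H\<close> dualizes to a quadratic lower bound for \<open>\<Phi>\<close>.\<close>

lemma quadratic_growth_of_lipschitz_argmin:
  fixes \<Phi> :: "'a::euclidean_space \<Rightarrow> ereal"
  assumes U: "open U" "convex U" and \<kappa>: "\<kappa> > 0" and lip: "\<kappa>-lipschitz_on U m"
    and fin: "\<And>v. v \<in> U \<Longrightarrow> \<Phi> (m v) = ereal (\<phi> v)" and mS: "\<And>v. v \<in> U \<Longrightarrow> m v \<in> S"
    and min: "\<And>v x. v \<in> U \<Longrightarrow> x \<in> S \<Longrightarrow> \<Phi> x \<ge> \<Phi> (m v) + ereal (v \<bullet> (x - m v))"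
    and v: "v \<in> U" and x: "x \<in> S" "v + (x - m v) /\<^sub>R \<kappa> \<in> U"
  shows "\<Phi> x \<ge> \<Phi> (m v) + ereal (v \<bullet> (x - m v) + 1 / (2 * \<kappa>) * (norm (x - m v))\<^sup>2)"
proof -
  define H where "H v = v \<bullet> m v - \<phi> v" for v
  \<comment> \<open>The maximizer over \<open>w\<close> of the inner product with \<open>x\<close>
    minus the quadratic upper bound for \<open>H w\<close>; it gives the best lower bound for
    \<open>\<Phi> x\<close>.\<close>
  define w where "w = v + (x - m v) /\<^sub>R \<kappa>"
  have sub: "H w \<ge> H v + m v \<bullet> (w - v)" if "v \<in> U" "w \<in> U" for v w
  proof -
    have "\<phi> v \<ge> \<phi> w + w \<bullet> (m v - m w)"
      using min[OF that(2) mS[OF that(1)]] fin[OF that(1)] fin[OF that(2)] by simp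
    then show ?thesis by (simp add: H_def inner_diff_right inner_commute[of "m v"])
  qed
  define d where "d = x - m v"
  have wU: "w \<in> U" using x(2) by (simp add: w_def)
  have wv: "w - v = (1 / \<kappa>) *\<^sub>R d" by (simp add: w_def d_def inverse_eq_divide)
  have "H w \<le> H v + m v \<bullet> (w - v) + \<kappa> / 2 * (norm (w - v))\<^sup>2"
    by (rule lipschitz_gradient_upper_bound[OF U v wU lip sub])
  moreover have "\<kappa> / 2 * (norm (w - v))\<^sup>2 = 1 / (2 * \<kappa>) * (norm d)\<^sup>2"
    unfolding wv using \<kappa> by (simp add: power_divide power2_eq_square)
  moreover have "w \<bullet> d = v \<bullet> d + 1 / \<kappa> * (norm d)\<^sup>2"
  proof -
    have "w \<bullet> d - v \<bullet> d = (w - v) \<bullet> d" by (rule inner_diff_left[symmetric])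
    then show ?thesis by (simp add: wv power2_norm_eq_inner)
  qed
  moreover have "1 / \<kappa> * (norm d)\<^sup>2 = 1 / (2 * \<kappa>) * (norm d)\<^sup>2 + 1 / (2 * \<kappa>) * (norm d)\<^sup>2"
    using \<kappa> by (simp add: field_simps)
  moreover have "x = d + m v" by (simp add: d_def)
  ultimately have "\<phi> v + (v \<bullet> d + 1 / (2 * \<kappa>) * (norm d)\<^sup>2) \<le> \<phi> w + w \<bullet> (x - m w)"
    by (simp add: H_def inner_diff_right inner_add_right inner_commute[of "m v"])
  also have "ereal \<dots> \<le> \<Phi> x"
    using min[OF wU x(1)] fin[OF wU] by simp
  finally show ?thesis by (simp add: fin[OF v] d_def)
qed

section \<open>Subgradients and perturbed minima\<close>

text \<open>A quadratic error is of smaller order than \<open>norm (y - x)\<close>. Minimality of a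
  linear or quadratic perturbation of \<open>f\<close> thus yields a regular subgradient.\<close>

lemma regular_subdiffI:
  assumes fin: "finite_at f x" and "d > 0"
    and bd: "\<And>y. norm (y - x) < d \<Longrightarrow> f y \<ge> f x + ereal (v \<bullet> (y - x) - C * (norm (y - x))\<^sup>2)"
  shows "v \<in> regular_subdiff f x"
proof -
  obtain a where a: "f x = ereal a" using fin by (cases "f x") (auto simp: finite_at_def)
  let ?q = "\<lambda>y. (f y - f x - ereal (v \<bullet> (y - x))) / ereal (norm (y - x))"
  have ev: "\<forall>\<^sub>F y in at x. ereal (- C * norm (y - x)) \<le> ?q y"
    unfolding eventually_at
  proof (intro exI[of _ d] conjI ballI impI)
    fix y assume y: "y \<noteq> x \<and> dist y x < d"
    then have n: "norm (y - x) > 0" by simp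
    have b: "f y \<ge> ereal (a + (v \<bullet> (y - x) - C * (norm (y - x))\<^sup>2))"
      using bd[of y] y by (simp add: a dist_norm)
    show "ereal (- C * norm (y - x)) \<le> ?q y"
    proof (cases "f y")
      case (real c)
      then show ?thesis using b n by (simp add: a field_simps power2_eq_square)
    next
      case PInf
      then show ?thesis using n by (simp add: a)
    next
      case MInf
      then show ?thesis using b by simp
    qed
  qed fact
  have "((\<lambda>y. ereal (- C * norm (y - x))) \<longlongrightarrow> ereal (- C * norm (x - x))) (at x)"
    by (intro tendsto_intros)
  then have "Liminf (at x) (\<lambda>y. ereal (- C * norm (y - x))) = 0"
    by (simp add: lim_imp_Liminf zero_ereal_def)
  with Liminf_mono[OF ev] have "0 \<le> Liminf (at x) ?q" by simp
  then show ?thesis using fin by (simp add: regular_subdiff_def)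
qed

lemma regular_subset_limiting_subdiff: "regular_subdiff f x \<subseteq> limiting_subdiff f x"
proof
  fix v assume v: "v \<in> regular_subdiff f x"
  then have "finite_at f x" by (simp add: regular_subdiff_def)
  moreover have "\<exists>X V. X \<longlonglongrightarrow> x \<and> (\<lambda>k::nat. f (X k)) \<longlonglongrightarrow> f x \<and> V \<longlonglongrightarrow> v \<and>
      (\<forall>k. V k \<in> regular_subdiff f (X k))"
    by (rule exI[where x = "\<lambda>_. x"], rule exI[where x = "\<lambda>_. v"]) (simp add: v)
  ultimately show "v \<in> limiting_subdiff f x" unfolding limiting_subdiff_def by blast
qed

text \<open>Only the sublevel sets below \<open>f xbar + \<epsilon>\<close> are closed, so the perturbation \<open>\<theta>\<close> must not let the
  competitors to \<open>xbar\<close> leave that range.\<close>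

lemma perturbed_minimum_exists:
  fixes f :: "'a::euclidean_space \<Rightarrow> ereal"
  assumes lsc: "\<And>\<alpha>::real. \<alpha> \<le> F0 + \<epsilon> \<Longrightarrow> closed {x \<in> cball xbar \<rho>. f x \<le> ereal \<alpha>}"
    and \<rho>: "\<rho> > 0" and f0: "f xbar = ereal F0" and bdd: "\<And>x. x \<in> cball xbar \<rho> \<Longrightarrow> f x \<ge> ereal B"
    and \<theta>: "continuous_on (cball xbar \<rho>) \<theta>"
    and small: "\<And>x. x \<in> cball xbar \<rho> \<Longrightarrow> \<theta> xbar - \<theta> x \<le> \<epsilon>"
  shows "\<exists>x\<in>cball xbar \<rho>. \<forall>y\<in>cball xbar \<rho>. f x + ereal (\<theta> x) \<le> f y + ereal (\<theta> y)"
proof -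
  let ?C = "cball xbar \<rho>"
  define \<phi> where "\<phi> x = f x + ereal (\<theta> x)" for x
  define m where "m = (INF x\<in>?C. \<phi> x)"
  have C0: "xbar \<in> ?C" using \<rho> by simp
  obtain T where T: "\<And>x. x \<in> ?C \<Longrightarrow> \<theta> x \<ge> T"
    using continuous_attains_inf[OF compact_cball _ \<theta>] C0 by blast
  have mle: "m \<le> \<phi> x" if "x \<in> ?C" for x unfolding m_def using that by (rule INF_lower)
  have "ereal (B + T) \<le> m" unfolding m_def
  proof (rule INF_greatest)
    fix x assume "x \<in> ?C"
    then have "ereal B + ereal T \<le> f x + ereal (\<theta> x)" by (intro add_mono bdd) (simp_all add: T)
    then show "ereal (B + T) \<le> \<phi> x" by (simp add: \<phi>_def)
  qed
  moreover have m0: "m \<le> ereal (F0 + \<theta> xbar)" using mle[OF C0] by (simp add: \<phi>_def f0)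
  ultimately obtain M where M: "m = ereal M" by (cases m) auto
  show ?thesis
  \<comment> \<open>If \<open>xbar\<close> is not itself a minimizer, a minimizing sequence can be
    kept strictly below the value at \<open>xbar\<close>. By \<open>small\<close>, this puts its
    \<open>f\<close>-values below \<open>F0 + \<epsilon>\<close>, where sublevel sets are
    closed.\<close>
  proof (cases "m = \<phi> xbar")
    case True
    then show ?thesis using mle C0 unfolding \<phi>_def by (intro bexI[of _ xbar]) auto
  next
    case False
    then have M0: "M < F0 + \<theta> xbar" using m0 by (simp add: M \<phi>_def f0)
    have "\<exists>x\<in>?C. \<phi> x < ereal (min (M + 1 / Suc n) (F0 + \<theta> xbar))" for n
    proof -
      have "m < ereal (min (M + 1 / Suc n) (F0 + \<theta> xbar))" using M0 by (simp add: M)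
      then show ?thesis unfolding m_def INF_less_iff by blast
    qed
    then obtain X where X: "\<And>n. X n \<in> ?C" "\<And>n. \<phi> (X n) < ereal (min (M + 1 / Suc n) (F0 + \<theta> xbar))" by metis
    obtain x r where x: "x \<in> ?C" "strict_mono (r::nat\<Rightarrow>nat)" "(X \<circ> r) \<longlonglongrightarrow> x"
      using compact_cball[of xbar \<rho>] X(1) unfolding compact_def by blast
    have \<theta>x: "(\<lambda>n. \<theta> (X (r n))) \<longlonglongrightarrow> \<theta> x"
      using continuous_on_tendsto_compose[OF \<theta> x(3) x(1)] X(1) by (simp add: o_def)
    have "(\<lambda>n. 1 / real (Suc (r n))) \<longlonglongrightarrow> 0"
      using LIMSEQ_subseq_LIMSEQ[OF LIMSEQ_Suc[OF lim_const_over_n[of 1]] x(2)] by (simp add: o_def)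
    from tendsto_diff[OF tendsto_add[OF tendsto_const[of M] this] \<theta>x]
    have lim: "(\<lambda>n. M + 1 / Suc (r n) - \<theta> (X (r n))) \<longlonglongrightarrow> M - \<theta> x" by simp
    have le: "f (X n) \<le> ereal (M + 1 / Suc n - \<theta> (X n))" "f (X n) \<le> ereal (F0 + \<epsilon>)" for n
    proof -
      have "f (X n) + ereal (\<theta> (X n)) < ereal (min (M + 1 / Suc n) (F0 + \<theta> xbar))"
        using X(2)[of n] by (simp only: \<phi>_def)
      then obtain c where "f (X n) = ereal c" "c + \<theta> (X n) < min (M + 1 / Suc n) (F0 + \<theta> xbar)"
        using bdd[OF X(1)[of n]] by (cases "f (X n)") auto
      then show "f (X n) \<le> ereal (M + 1 / Suc n - \<theta> (X n))" "f (X n) \<le> ereal (F0 + \<epsilon>)"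
        using small[OF X(1)[of n]] by simp_all
    qed
    have le\<beta>: "f x \<le> ereal \<beta>" if \<beta>: "\<beta> > M - \<theta> x" for \<beta>
    proof -
      \<comment> \<open>The level is capped so that closedness is available for it.\<close>
      define \<alpha> where "\<alpha> = min \<beta> (F0 + \<epsilon>)"
      have "\<forall>\<^sub>F n in sequentially. M + 1 / Suc (r n) - \<theta> (X (r n)) < \<beta>"
        using order_tendstoD(2)[OF lim \<beta>] .
      then have "\<forall>\<^sub>F n in sequentially. (X \<circ> r) n \<in> {x \<in> ?C. f x \<le> ereal \<alpha>}"
      proof eventually_elim
        case (elim n)
        have "f (X (r n)) \<le> ereal \<beta>"
          by (rule order_trans[OF le(1)]) (use elim in simp)
        then show ?case using le(2)[of "r n"] X(1)[of "r n"] by (simp add: \<alpha>_def min_def)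
      qed
      moreover have "closed {x \<in> ?C. f x \<le> ereal \<alpha>}" by (rule lsc) (simp add: \<alpha>_def)
      ultimately have "x \<in> {x \<in> ?C. f x \<le> ereal \<alpha>}"
        by (intro Lim_in_closed_set[OF _ _ _ x(3)]) auto
      then have "f x \<le> ereal \<alpha>" by simp
      also have "ereal \<alpha> \<le> ereal \<beta>" by (simp add: \<alpha>_def)
      finally show ?thesis .
    qed
    have "f x \<le> ereal (M - \<theta> x)"
    proof (rule ereal_le_epsilon2)
      fix e :: real assume "0 < e"
      then show "f x \<le> ereal (M - \<theta> x) + ereal e" using le\<beta>[of "M - \<theta> x + e"] by simp
    qed
    then have "\<phi> x \<le> m" by (cases "f x") (auto simp: \<phi>_def M)
    then show ?thesis using mle x(1) unfolding \<phi>_def by (meson order_trans)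
  qed
qed

section \<open>The localized proximal map\<close>

lemma norm_sq_expand:
  fixes x y b :: "'a::real_inner"
  shows "(norm (y - b))\<^sup>2 = (norm (x - b))\<^sup>2 + 2 * ((x - b) \<bullet> (y - x)) + (norm (y - x))\<^sup>2"
proof -
  have "y - b = (x - b) + (y - x)" by simp
  then show ?thesis by (simp only: power2_norm_eq_inner inner_add_left inner_add_right inner_commute)
qed

text \<open>Adding the two inequalities gives strong monotonicity with modulus \<open>2 * C\<close>,
  and Cauchy-Schwarz finishes. With equal tilts this is uniqueness, with different tilts a Lipschitz
  estimate.\<close>

lemma growth_expansive:
  fixes \<Phi> :: "'a::real_inner \<Rightarrow> ereal"
  assumes fin: "\<Phi> x = ereal a" "\<Phi> y = ereal b"
    and "\<Phi> y \<ge> \<Phi> x + ereal (z \<bullet> (y - x) + C * (norm (y - x))\<^sup>2)"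
    and "\<Phi> x \<ge> \<Phi> y + ereal (w \<bullet> (x - y) + C * (norm (x - y))\<^sup>2)"
  shows "2 * C * norm (x - y) \<le> norm (z - w)"
proof -
  have "b \<ge> a + (z \<bullet> (y - x) + C * (norm (y - x))\<^sup>2)" "a \<ge> b + (w \<bullet> (x - y) + C * (norm (x - y))\<^sup>2)"
    using assms by simp_all
  then have "(2 * C * norm (x - y)) * norm (x - y) \<le> (z - w) \<bullet> (x - y)"
    by (simp add: norm_minus_commute[of y x] power2_eq_square inner_diff_left inner_diff_right)
  also have "\<dots> \<le> norm (z - w) * norm (x - y)" by (rule norm_cauchy_schwarz)
  finally show ?thesis by (cases "x = y") auto
qed

text \<open>The hypotheses at \<open>xbar\<close> for the subgradient 0, with a single radius. The
  restriction on function values in prox-regularity has been absorbed by subdifferential continuity.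
  The bound \<open>\<epsilon> \<le> 1\<close> ensures that a tilt of norm at most 1 varies by at
  most \<open>\<epsilon>\<close> from its value at \<open>xbar\<close>.\<close>

locale local_prox =
  fixes f :: "'a::euclidean_space \<Rightarrow> ereal" and xbar :: 'a and F0 \<epsilon> r :: real
  assumes f_xbar: "f xbar = ereal F0" and \<epsilon>: "0 < \<epsilon>" "\<epsilon> \<le> 1" and r: "0 \<le> r"
    and lsc: "\<And>\<alpha>. \<alpha> \<le> F0 + \<epsilon> \<Longrightarrow> closed {x \<in> cball xbar \<epsilon>. f x \<le> ereal \<alpha>}"
    and zero_sub: "0 \<in> limiting_subdiff f xbar"
    and prox: "\<And>x v x'. v \<in> limiting_subdiff f x \<Longrightarrow> norm (x - xbar) \<le> \<epsilon> \<Longrightarrow> norm v \<le> \<epsilon> \<Longrightarrow>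
      x' \<in> cball xbar \<epsilon> \<Longrightarrow> f x' \<ge> f x + ereal (v \<bullet> (x' - x) - r / 2 * (norm (x' - x))\<^sup>2)"
begin

definition \<mu> :: real where "\<mu> = r + 1"
text \<open>For tilts \<open>z\<close> of norm below \<open>\<delta>\<close> the subgradient
  attached to \<open>P z\<close> has norm at most \<open>(2 * \<mu> + 1) * norm z\<close>, which
  stays below \<open>\<epsilon>\<close>.\<close>

definition \<delta> :: real where "\<delta> = \<epsilon> / (2 * \<mu> + 1)"
definition F :: "'a \<Rightarrow> ereal" where "F x = f x + ereal (\<mu> / 2 * (norm (x - xbar))\<^sup>2)"

text \<open>The choice is made by the stationarity condition for \<open>F\<close> tilted by
  \<open>z\<close>, together with a distance bound. That the chosen point is the minimizer over the
  ball follows in \<open>P_growth\<close>.\<close>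

definition P :: "'a \<Rightarrow> 'a" where
  "P z = (SOME x. norm (x - xbar) \<le> 2 * norm z \<and> z - \<mu> *\<^sub>R (x - xbar) \<in> limiting_subdiff f x)"

lemma \<mu>: "1 \<le> \<mu>" using r by (simp add: \<mu>_def)

lemma \<delta>_pos: "0 < \<delta>" using \<epsilon> \<mu> by (simp add: \<delta>_def)

lemma \<delta>_bound: "norm z < \<delta> \<Longrightarrow> (2 * \<mu> + 1) * norm z < \<epsilon>"
  using \<mu> by (simp add: \<delta>_def field_simps)

lemma small_norm:
  assumes "norm z < \<delta>" shows "2 * norm z < \<epsilon>" "norm z \<le> 1"
proof -
  have "norm z \<le> \<mu> * norm z" using mult_right_mono[OF \<mu> norm_ge_zero[of z]] by simp
  moreover have "2 * (\<mu> * norm z) + norm z < \<epsilon>" using \<delta>_bound[OF assms] by (simp add: algebra_simps)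
  ultimately show "2 * norm z < \<epsilon>" using norm_ge_zero[of z] by linarith
  then show "norm z \<le> 1" using \<epsilon> norm_ge_zero[of z] by linarith
qed

lemma f_lower: "x \<in> cball xbar \<epsilon> \<Longrightarrow> f x \<ge> ereal (F0 - r / 2 * (norm (x - xbar))\<^sup>2)"
  using prox[OF zero_sub, of x] \<epsilon> by (simp add: f_xbar)

lemma f_finite: "v \<in> limiting_subdiff f x \<Longrightarrow> \<exists>a. f x = ereal a"
  by (cases "f x") (auto simp: limiting_subdiff_def finite_at_def)

text \<open>The quadratic term in \<open>F\<close> contributes growth \<open>\<mu> / 2\<close>; the
  part \<open>r / 2\<close> compensates the loss in the prox-regularity inequality and 1/2
  remains.\<close>

lemma F_growth:
  assumes v: "v \<in> limiting_subdiff f x" "norm (x - xbar) \<le> \<epsilon>" "norm v \<le> \<epsilon>"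
    and x': "x' \<in> cball xbar \<epsilon>"
  shows "F x' \<ge> F x + ereal ((v + \<mu> *\<^sub>R (x - xbar)) \<bullet> (x' - x) + 1 / 2 * (norm (x' - x))\<^sup>2)"
proof -
  obtain a where a: "f x = ereal a" using f_finite[OF v(1)] by blast
  have "ereal (a + (v \<bullet> (x' - x) - r / 2 * (norm (x' - x))\<^sup>2)) \<le> f x'"
    using prox[OF v x'] by (simp add: a)
  moreover have "\<mu> / 2 * (norm (x' - xbar))\<^sup>2 = \<mu> / 2 * (norm (x - xbar))\<^sup>2 + \<mu> * ((x - xbar) \<bullet> (x' - x))
      + (1 / 2 * (norm (x' - x))\<^sup>2 + r / 2 * (norm (x' - x))\<^sup>2)"
    unfolding norm_sq_expand[of x' xbar x] by (simp add: \<mu>_def field_simps)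
  ultimately show ?thesis
    by (cases "f x'") (simp_all add: F_def a inner_add_left add_divide_distrib)
qed

text \<open>Minimize the tilted \<open>F\<close> over the ball. Comparison with \<open>xbar\<close>
  and the lower bound \<open>f_lower\<close> leave half the squared distance on the left, so the
  distance of the minimizer is at most \<open>2 * norm z\<close>. It is interior, and stationarity
  follows.\<close>

lemma P_exists:
  assumes z: "norm z < \<delta>"
  shows "\<exists>x. norm (x - xbar) \<le> 2 * norm z \<and> z - \<mu> *\<^sub>R (x - xbar) \<in> limiting_subdiff f x"
proof -
  define \<theta> where "\<theta> y = \<mu> / 2 * (norm (y - xbar))\<^sup>2 - z \<bullet> y" for y
  have "\<exists>x\<in>cball xbar \<epsilon>. \<forall>y\<in>cball xbar \<epsilon>. f x + ereal (\<theta> x) \<le> f y + ereal (\<theta> y)"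
  proof (rule perturbed_minimum_exists[where ?F0.0 = F0 and \<epsilon> = \<epsilon> and B = "F0 - r / 2 * \<epsilon>\<^sup>2"])
    show "continuous_on (cball xbar \<epsilon>) \<theta>" unfolding \<theta>_def by (intro continuous_intros)
    fix x assume x: "x \<in> cball xbar \<epsilon>"
    then have n: "norm (x - xbar) \<le> \<epsilon>" by (simp add: dist_norm norm_minus_commute)
    then have "(norm (x - xbar))\<^sup>2 \<le> \<epsilon>\<^sup>2" by (intro power_mono) auto
    then have "F0 - r / 2 * \<epsilon>\<^sup>2 \<le> F0 - r / 2 * (norm (x - xbar))\<^sup>2"
      using r by (simp add: mult_left_mono)
    then show "ereal (F0 - r / 2 * \<epsilon>\<^sup>2) \<le> f x"
      using f_lower[OF x] by (meson ereal_less_eq(3) order_trans)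
    have "z \<bullet> (x - xbar) \<le> norm z * norm (x - xbar)" by (rule norm_cauchy_schwarz)
    also have "\<dots> \<le> 1 * \<epsilon>" using n small_norm(2)[OF z] by (intro mult_mono) auto
    finally have "z \<bullet> (x - xbar) \<le> \<epsilon>" by simp
    moreover have "0 \<le> \<mu> / 2 * (norm (x - xbar))\<^sup>2" using \<mu> by simp
    ultimately show "\<theta> xbar - \<theta> x \<le> \<epsilon>" by (simp add: \<theta>_def inner_diff_right)
  qed (use \<epsilon> lsc in \<open>simp_all add: f_xbar\<close>)
  then obtain x where x: "x \<in> cball xbar \<epsilon>"
    and min: "\<And>y. y \<in> cball xbar \<epsilon> \<Longrightarrow> f x + ereal (\<theta> x) \<le> f y + ereal (\<theta> y)" by blast
  have mx: "f x + ereal (\<theta> x) \<le> ereal (F0 + \<theta> xbar)" using min[of xbar] \<epsilon> by (simp add: f_xbar)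
  then obtain a where a: "f x = ereal a" using f_lower[OF x] by (cases "f x") auto
  define d where "d = norm (x - xbar)"
  have "F0 - r / 2 * d\<^sup>2 \<le> a" using f_lower[OF x] by (simp add: a d_def)
  moreover have "a + \<theta> x \<le> F0 + \<theta> xbar" using mx by (simp add: a)
  ultimately have "\<mu> / 2 * d\<^sup>2 - r / 2 * d\<^sup>2 \<le> z \<bullet> (x - xbar)"
    by (simp add: \<theta>_def d_def inner_diff_right)
  also have "\<dots> \<le> norm z * d" unfolding d_def by (rule norm_cauchy_schwarz)
  finally have "d * d \<le> (2 * norm z) * d" by (simp add: \<mu>_def power2_eq_square field_simps)
  then have d: "d \<le> 2 * norm z" by (cases "d = 0") (auto simp: d_def)
  have "z - \<mu> *\<^sub>R (x - xbar) \<in> regular_subdiff f x"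
  proof (rule regular_subdiffI)
    show "finite_at f x" by (simp add: finite_at_def a)
    show "0 < \<epsilon> - d" using d small_norm(1)[OF z] by simp
    fix y assume "norm (y - x) < \<epsilon> - d"
    then have "y \<in> cball xbar \<epsilon>"
      unfolding d_def mem_cball dist_norm using norm_triangle_ineq[of "y - x" "x - xbar"]
      by (simp add: norm_minus_commute)
    from min[OF this] have "ereal (a + \<theta> x) \<le> f y + ereal (\<theta> y)" by (simp add: a)
    moreover have "\<theta> x - \<theta> y = (z - \<mu> *\<^sub>R (x - xbar)) \<bullet> (y - x) - \<mu> / 2 * (norm (y - x))\<^sup>2"
      unfolding \<theta>_def norm_sq_expand[of y xbar x]
      by (simp add: inner_diff_left inner_diff_right inner_add_left field_simps)
    ultimately show "f y \<ge> f x + ereal ((z - \<mu> *\<^sub>R (x - xbar)) \<bullet> (y - x) - \<mu> / 2 * (norm (y - x))\<^sup>2)"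
      by (cases "f y") (simp_all add: a)
  qed
  then show ?thesis using d regular_subset_limiting_subdiff unfolding d_def by blast
qed

lemma
  assumes "norm z < \<delta>"
  shows P_near: "norm (P z - xbar) \<le> 2 * norm z"
    and P_subgradient: "z - \<mu> *\<^sub>R (P z - xbar) \<in> limiting_subdiff f (P z)"
  using someI_ex[OF P_exists[OF assms]] unfolding P_def by blast+

lemma P_subgradient_near:
  assumes "norm z < \<delta>"
  shows "norm (z - \<mu> *\<^sub>R (P z - xbar)) \<le> (2 * \<mu> + 1) * norm z"
proof -
  have "norm (z - \<mu> *\<^sub>R (P z - xbar)) \<le> norm z + \<mu> * norm (P z - xbar)"
    using norm_triangle_ineq4[of z "\<mu> *\<^sub>R (P z - xbar)"] \<mu> by simp
  also have "\<dots> \<le> norm z + \<mu> * (2 * norm z)"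
    using P_near[OF assms] \<mu> by (intro add_left_mono mult_left_mono) auto
  finally show ?thesis by (simp add: algebra_simps)
qed

lemma P_in_cball: "norm z < \<delta> \<Longrightarrow> P z \<in> cball xbar \<epsilon>"
  using P_near[of z] small_norm(1)[of z] by (simp add: dist_norm norm_minus_commute)

lemma P_growth:
  assumes z: "norm z < \<delta>" and x': "x' \<in> cball xbar \<epsilon>"
  shows "F x' \<ge> F (P z) + ereal (z \<bullet> (x' - P z) + 1 / 2 * (norm (x' - P z))\<^sup>2)"
proof -
  have "norm (P z - xbar) \<le> \<epsilon>" using P_in_cball[OF z] by (simp add: dist_norm norm_minus_commute)
  moreover have "norm (z - \<mu> *\<^sub>R (P z - xbar)) \<le> \<epsilon>"
    using P_subgradient_near[OF z] \<delta>_bound[OF z] by simp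
  ultimately show ?thesis using F_growth[OF P_subgradient[OF z] _ _ x'] by simp
qed

definition \<phi> :: "'a \<Rightarrow> real" where "\<phi> z = real_of_ereal (F (P z))"

lemma F_P: "norm z < \<delta> \<Longrightarrow> F (P z) = ereal (\<phi> z)"
  using f_finite[OF P_subgradient[of z]] by (auto simp: \<phi>_def F_def)

lemma P_lipschitz: "1-lipschitz_on (ball 0 \<delta>) P"
proof (rule lipschitz_onI)
  fix z w :: 'a assume "z \<in> ball 0 \<delta>" "w \<in> ball 0 \<delta>"
  then have zw: "norm z < \<delta>" "norm w < \<delta>" by simp_all
  then show "dist (P z) (P w) \<le> 1 * dist z w"
    using growth_expansive[where \<Phi> = F and C = "1 / 2", OF F_P[OF zw(1)] F_P[OF zw(2)]
      P_growth[OF zw(1) P_in_cball[OF zw(2)]] P_growth[OF zw(2) P_in_cball[OF zw(1)]]]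
    by (simp add: dist_norm)
qed simp

text \<open>Every graph point near \<open>(xbar, 0)\<close> is thus reached by the parametrization.
  Both \<open>x\<close> and the value of \<open>P\<close> satisfy the growth inequality for the same
  tilt, so \<open>growth_expansive\<close> makes them equal.\<close>

lemma P_unique:
  assumes v: "v \<in> limiting_subdiff f x" "norm (x - xbar) \<le> \<epsilon>" "norm v \<le> \<epsilon>"
    and z: "norm (v + \<mu> *\<^sub>R (x - xbar)) < \<delta>"
  shows "P (v + \<mu> *\<^sub>R (x - xbar)) = x"
proof -
  obtain a where "F x = ereal a" using f_finite[OF v(1)] by (auto simp: F_def)
  moreover have "x \<in> cball xbar \<epsilon>" using v(2) by (simp add: dist_norm norm_minus_commute)
  ultimately have "2 * (1 / 2) * norm (x - P (v + \<mu> *\<^sub>R (x - xbar))) \<le> norm ((v + \<mu> *\<^sub>R (x - xbar)) - (v + \<mu> *\<^sub>R (x - xbar)))"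
    using growth_expansive[where \<Phi> = F and C = "1 / 2", OF _ F_P[OF z] F_growth[OF v P_in_cball[OF z]] P_growth[OF z]] by blast
  then show ?thesis by simp
qed

end

section \<open>Epi-convergence of second-order difference quotients\<close>

lemma Liminf_le_along:
  fixes X :: "'a \<Rightarrow> ereal"
  assumes "filterlim h F G"
  shows "Liminf F X \<le> Liminf G (\<lambda>t. X (h t))"
  unfolding le_Liminf_iff
proof (intro allI impI)
  fix y assume "y < Liminf F X"
  then have "eventually (\<lambda>x. y < X x) F" using le_Liminf_iff[of "Liminf F X" F X] by blast
  then show "eventually (\<lambda>t. y < X (h t)) G" using assms unfolding filterlim_iff by blast
qed

lemma le_Liminf_of_tendsto:
  fixes X :: "'a \<Rightarrow> ereal"
  assumes "F \<noteq> bot" "(h \<longlongrightarrow> l) F" "eventually (\<lambda>x. ereal (h x) \<le> X x) F"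
  shows "ereal l \<le> Liminf F X"
proof -
  have "Liminf F (\<lambda>x. ereal (h x)) = ereal l"
    using assms by (intro lim_imp_Liminf tendsto_intros)
  then show ?thesis using Liminf_mono[OF assms(3)] by simp
qed

lemma second_subderiv_filter_nontrivial: "at_right (0::real) \<times>\<^sub>F nhds (w::'a::euclidean_space) \<noteq> bot"
  by (simp add: prod_filter_eq_bot)

lemma inner_limit_subset_outer_limit: "inner_limit C \<subseteq> outer_limit (C :: real \<Rightarrow> 'b::topological_space set)"
proof
  fix z assume z: "z \<in> inner_limit C"
  define T :: "nat \<Rightarrow> real" where "T n = 1 / real (Suc n)" for n
  have T: "filterlim T (at_right 0) sequentially"
    unfolding T_def by (intro tendsto_imp_filterlim_at_right LIMSEQ_Suc[OF lim_const_over_n]) simp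
  with z obtain Z where Z: "\<forall>\<^sub>F k in sequentially. Z k \<in> C (T k)" "Z \<longlonglongrightarrow> z"
    unfolding inner_limit_def by blast
  then obtain N where N: "\<And>k. k \<ge> N \<Longrightarrow> Z k \<in> C (T k)" unfolding eventually_sequentially by blast
  \<comment> \<open>Membership holds only eventually, while the outer limit asks for every index;
    the first \<open>N\<close> terms are dropped.\<close>
  have "filterlim (\<lambda>k. T (k + N)) (at_right 0) sequentially"
    using T filterlim_compose filterlim_add_const_nat_at_top by blast
  moreover have "(\<lambda>k. Z (k + N)) \<longlonglongrightarrow> z" using Z(2) by (rule LIMSEQ_ignore_initial_segment)
  ultimately show "z \<in> outer_limit C" unfolding outer_limit_def using N
    by (intro CollectI exI[of _ "\<lambda>k. T (k + N)"] exI[of _ "\<lambda>k. Z (k + N)"]) simp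
qed

text \<open>The second subderivative is a lower limit over all approaches of \<open>(t, u)\<close>,
  so this half of epi-convergence always holds; only recovery sequences have to be supplied.\<close>

lemma outer_limit_subset_epi_second_subderiv:
  "outer_limit (\<lambda>t. epi (second_diff_quot f x v t)) \<subseteq> epi (second_subderiv f x v)"
proof
  fix z assume "z \<in> outer_limit (\<lambda>t. epi (second_diff_quot f x v t))"
  then obtain T Z where T: "filterlim T (at_right 0) sequentially"
    and Z: "\<And>k. Z k \<in> epi (second_diff_quot f x v (T k))" "Z \<longlonglongrightarrow> z"
    unfolding outer_limit_def by blast
  have "filterlim (\<lambda>k. (T k, fst (Z k))) (at_right 0 \<times>\<^sub>F nhds (fst z)) sequentially"
    by (intro filterlim_Pair T tendsto_fst Z(2))
  from Liminf_le_along[OF this, of "\<lambda>(t, u). second_diff_quot f x v t u"]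
  have "second_subderiv f x v (fst z) \<le> Liminf sequentially (\<lambda>k. second_diff_quot f x v (T k) (fst (Z k)))"
    by (simp add: second_subderiv_def)
  also have "\<dots> \<le> Liminf sequentially (\<lambda>k. ereal (snd (Z k)))"
  proof (intro Liminf_mono always_eventually allI)
    show "second_diff_quot f x v (T k) (fst (Z k)) \<le> ereal (snd (Z k))" for k
      using Z(1)[of k] by (cases "Z k") (simp add: epi_def)
  qed
  also have "\<dots> = ereal (snd z)"
    by (intro lim_imp_Liminf tendsto_intros tendsto_snd Z(2)) simp
  finally show "z \<in> epi (second_subderiv f x v)" by (simp add: epi_def case_prod_unfold)
qed

lemma twice_epi_differentiableI:
  assumes "finite_at f x"
    and "epi (second_subderiv f x v) \<subseteq> inner_limit (\<lambda>t. epi (second_diff_quot f x v t))"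
  shows "twice_epi_differentiable f x v"
  using assms outer_limit_subset_epi_second_subderiv[of f x v]
    inner_limit_subset_outer_limit[of "\<lambda>t. epi (second_diff_quot f x v t)"]
  unfolding twice_epi_differentiable_def epi_converges_def PK_converges_def by blast

section \<open>Second-order expansion of the conjugate \<open>g\<close>\<close>

context local_prox
begin

text \<open>For \<open>norm w < \<delta>\<close> this is the conjugate of \<open>F\<close>
  restricted to the ball, because \<open>P_growth\<close> makes \<open>P w\<close> the
  maximizer.\<close>

definition g :: "'a \<Rightarrow> real" where "g w = w \<bullet> P w - \<phi> w"

lemma g_subgradient:
  assumes "w \<in> ball 0 \<delta>" "w' \<in> ball 0 \<delta>"
  shows "g w' \<ge> g w + P w \<bullet> (w' - w)"
proof -
  have n: "norm w < \<delta>" "norm w' < \<delta>" using assms by simp_all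
  have "\<phi> w \<ge> \<phi> w' + (w' \<bullet> (P w - P w') + 1 / 2 * (norm (P w - P w'))\<^sup>2)"
    using P_growth[OF n(2) P_in_cball[OF n(1)]] by (simp add: F_P n)
  then have "\<phi> w \<ge> \<phi> w' + w' \<bullet> (P w - P w')"
    by (smt (verit) zero_le_power2 divide_nonneg_nonneg mult_nonneg_nonneg)
  then show ?thesis by (simp add: g_def inner_diff_right inner_commute[of "P w"])
qed

definition g_quot :: "'a \<Rightarrow> 'a \<Rightarrow> real \<Rightarrow> real" where
  "g_quot z y t = (g (z + t *\<^sub>R y) - g z - t * (P z \<bullet> y)) / (t\<^sup>2 / 2)"

lemma eventually_small: "norm z < \<delta> \<Longrightarrow> \<forall>\<^sub>F t in at_right 0. norm (z + t *\<^sub>R y) < \<delta>"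
proof -
  assume z: "norm z < \<delta>"
  have "((\<lambda>t. norm (z + t *\<^sub>R y)) \<longlongrightarrow> norm (z + 0 *\<^sub>R y)) (at_right 0)"
    by (intro tendsto_intros)
  from order_tendstoD(2)[OF this, of \<delta>] show ?thesis using z by simp
qed

text \<open>\<open>P\<close> is the gradient of \<open>g\<close> and is differentiable only in one
  direction at the single point \<open>z\<close>. One application of l'Hospital's rule turns the
  second-order quotient of \<open>g\<close> into the first-order quotient of
  \<open>P\<close>.\<close>

lemma g_quot_tendsto:
  assumes z: "norm z < \<delta>" and lim: "((\<lambda>t. (P (z + t *\<^sub>R y) - P z) /\<^sub>R t) \<longlongrightarrow> a) (at_right 0)"
  shows "(g_quot z y \<longlongrightarrow> a \<bullet> y) (at_right 0)"
  unfolding g_quot_def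
proof (rule lhopital_right_0[where f' = "\<lambda>t. P (z + t *\<^sub>R y) \<bullet> y - P z \<bullet> y" and g' = "\<lambda>t. t"])
  have der: "((\<lambda>t. g (z + t *\<^sub>R y)) has_real_derivative P (z + t *\<^sub>R y) \<bullet> y) (at t)"
    if "norm (z + t *\<^sub>R y) < \<delta>" for t
    using that by (intro has_real_derivative_along_line has_derivative_of_subgradient[where U = "ball 0 \<delta>"]
        lipschitz_on_continuous_on[OF P_lipschitz] g_subgradient) auto
  have "isCont (\<lambda>t. g (z + t *\<^sub>R y)) 0" using DERIV_isCont[OF der[of 0]] z by simp
  then have "((\<lambda>t. g (z + t *\<^sub>R y)) \<longlongrightarrow> g (z + 0 *\<^sub>R y)) (at_right 0)"
    unfolding isCont_def by (rule tendsto_within_subset) simp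
  then have "((\<lambda>t. g (z + t *\<^sub>R y) - g z - t * (P z \<bullet> y)) \<longlongrightarrow> g (z + 0 *\<^sub>R y) - g z - 0 * (P z \<bullet> y)) (at_right 0)"
    by (intro tendsto_diff tendsto_mult tendsto_const tendsto_ident_at)
  then show "((\<lambda>t. g (z + t *\<^sub>R y) - g z - t * (P z \<bullet> y)) \<longlongrightarrow> 0) (at_right 0)" by simp
  have "((\<lambda>t. t\<^sup>2 / 2) \<longlongrightarrow> 0\<^sup>2 / 2) (at_right (0::real))" by (intro tendsto_intros) simp
  then show "((\<lambda>t. t\<^sup>2 / 2) \<longlongrightarrow> 0) (at_right (0::real))" by simp
  have pos: "\<forall>\<^sub>F t in at_right (0::real). t > 0" by (rule eventually_at_right_less)
  show "\<forall>\<^sub>F t in at_right (0::real). t\<^sup>2 / 2 \<noteq> 0" "\<forall>\<^sub>F t in at_right (0::real). t \<noteq> 0"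
    using pos by (auto elim: eventually_mono)
  show "\<forall>\<^sub>F t in at_right 0. ((\<lambda>t. g (z + t *\<^sub>R y) - g z - t * (P z \<bullet> y))
      has_real_derivative P (z + t *\<^sub>R y) \<bullet> y - P z \<bullet> y) (at t)"
    using eventually_small[OF z, of y]
  proof eventually_elim
    case (elim t)
    from der[OF this] show ?case by (auto intro!: derivative_eq_intros)
  qed
  show "\<forall>\<^sub>F t in at_right (0::real). ((\<lambda>t. t\<^sup>2 / 2) has_real_derivative t) (at t)"
    by (intro always_eventually allI) (auto intro!: derivative_eq_intros)
  show "((\<lambda>t. (P (z + t *\<^sub>R y) \<bullet> y - P z \<bullet> y) / t) \<longlongrightarrow> a \<bullet> y) (at_right 0)"
    using tendsto_inner[OF lim tendsto_const[of y]]
    by (simp add: inner_diff_left divide_inverse mult.commute)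
qed

text \<open>The Fenchel-Young lower bound for \<open>F\<close> at \<open>P z + t u\<close> with tilt
  \<open>z + t y\<close>, rewritten as a second-order quotient of \<open>f\<close>; the last term
  removes the quadratic part of \<open>F\<close>.\<close>

definition dual_quot :: "'a \<Rightarrow> 'a \<Rightarrow> real \<Rightarrow> 'a \<Rightarrow> real" where
  "dual_quot z y t u = 2 * (y \<bullet> u) - g_quot z y t - \<mu> * (norm u)\<^sup>2"

text \<open>The number \<open>c\<close> is the Fenchel-Young bound for \<open>F\<close> at the
  displaced point. The quotient of \<open>f\<close> exceeds \<open>dual_quot\<close> by exactly the
  gap in that bound divided by half of the square of \<open>t\<close>, so inequality and equality
  both carry over.\<close>

lemma second_diff_quot_eq:
  assumes z: "norm z < \<delta>" and t: "t > 0" and w: "norm (z + t *\<^sub>R y) < \<delta>"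
    and c: "c = (z + t *\<^sub>R y) \<bullet> (P z + t *\<^sub>R u) - g (z + t *\<^sub>R y)"
  shows "F (P z + t *\<^sub>R u) \<ge> ereal c \<Longrightarrow>
      second_diff_quot f (P z) (z - \<mu> *\<^sub>R (P z - xbar)) t u \<ge> ereal (dual_quot z y t u)"
    and "F (P z + t *\<^sub>R u) = ereal c \<Longrightarrow>
      second_diff_quot f (P z) (z - \<mu> *\<^sub>R (P z - xbar)) t u = ereal (dual_quot z y t u)"
proof -
  define x where "x = P z"
  define k where "k = \<mu> / 2 * (norm (x - xbar))\<^sup>2"
  define j where "j = t * \<mu> * ((x - xbar) \<bullet> u) + t\<^sup>2 * (\<mu> / 2 * (norm u)\<^sup>2)"
  obtain a where a: "f x = ereal a" using f_finite[OF P_subgradient[OF z]] by (auto simp: x_def)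
  have "F x = ereal (\<phi> z)" using F_P[OF z] by (simp add: x_def)
  then have ak: "a + k = z \<bullet> x - g z" by (simp add: F_def a k_def g_def x_def[symmetric])
  have Fu: "F (x + t *\<^sub>R u) = f (x + t *\<^sub>R u) + ereal (k + j)"
    unfolding F_def norm_sq_expand[of "x + t *\<^sub>R u" xbar x]
    by (simp add: k_def j_def power_mult_distrib algebra_simps)
  have eq: "b - a - t * ((z - \<mu> *\<^sub>R (x - xbar)) \<bullet> u) - t\<^sup>2 / 2 * dual_quot z y t u = b + (k + j) - c" for b
  proof -
    have "t\<^sup>2 / 2 * g_quot z y t = g (z + t *\<^sub>R y) - g z - t * (x \<bullet> y)"
      using t by (simp add: g_quot_def x_def)
    then have "t\<^sup>2 / 2 * dual_quot z y t u =
        t\<^sup>2 * (y \<bullet> u) - (g (z + t *\<^sub>R y) - g z - t * (x \<bullet> y)) - t\<^sup>2 * (\<mu> / 2 * (norm u)\<^sup>2)"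
      by (simp add: dual_quot_def right_diff_distrib diff_divide_distrib)
    then show ?thesis
      using ak unfolding c j_def
      by (simp add: x_def[symmetric] inner_diff_left inner_add_left inner_add_right inner_commute[of y x] algebra_simps power2_eq_square)
  qed
  have q: "second_diff_quot f x (z - \<mu> *\<^sub>R (x - xbar)) t u
      = ereal ((b - a - t * ((z - \<mu> *\<^sub>R (x - xbar)) \<bullet> u)) / (t\<^sup>2 / 2))" if "f (x + t *\<^sub>R u) = ereal b" for b
    using t that by (simp add: second_diff_quot_def a)
  have t2: "t\<^sup>2 / 2 > 0" using t by simp
  show "second_diff_quot f (P z) (z - \<mu> *\<^sub>R (P z - xbar)) t u \<ge> ereal (dual_quot z y t u)"
    if "F (P z + t *\<^sub>R u) \<ge> ereal c"
  proof (cases "f (x + t *\<^sub>R u)")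
    case (real b)
    then have "0 \<le> b + (k + j) - c" using that Fu by (simp add: x_def)
    then have "t\<^sup>2 / 2 * dual_quot z y t u \<le> b - a - t * ((z - \<mu> *\<^sub>R (x - xbar)) \<bullet> u)"
      using eq[of b] by linarith
    then have "dual_quot z y t u \<le> (b - a - t * ((z - \<mu> *\<^sub>R (x - xbar)) \<bullet> u)) / (t\<^sup>2 / 2)"
      by (subst pos_le_divide_eq[OF t2]) (simp only: mult.commute)
    then show ?thesis using q[OF real] by (simp add: x_def)
  next
    case PInf
    then show ?thesis using t by (simp add: second_diff_quot_def a x_def[symmetric])
  next
    case MInf
    then show ?thesis using that Fu by (simp add: x_def)
  qed
  show "second_diff_quot f (P z) (z - \<mu> *\<^sub>R (P z - xbar)) t u = ereal (dual_quot z y t u)"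
    if Fc: "F (P z + t *\<^sub>R u) = ereal c"
  proof -
    obtain b where b: "f (x + t *\<^sub>R u) = ereal b" using Fc Fu by (cases "f (x + t *\<^sub>R u)") (auto simp: x_def)
    then have "b + (k + j) - c = 0" using Fc Fu by (simp add: x_def)
    then have "b - a - t * ((z - \<mu> *\<^sub>R (x - xbar)) \<bullet> u) = dual_quot z y t u * (t\<^sup>2 / 2)"
      using eq[of b] by (simp only: mult.commute)
    then have "(b - a - t * ((z - \<mu> *\<^sub>R (x - xbar)) \<bullet> u)) / (t\<^sup>2 / 2) = dual_quot z y t u"
      using t2 by (subst nonzero_divide_eq_eq) simp_all
    then show ?thesis using q[OF b] by (simp add: x_def)
  qed
qed

end

section \<open>Bounds and values of the second subderivative\<close>

lemma eventually_segment_in_open: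
  fixes x w :: "'a::real_normed_vector"
  assumes "open U" "x \<in> U"
  shows "\<forall>\<^sub>F (t, u) in at_right 0 \<times>\<^sub>F nhds w. x + t *\<^sub>R u \<in> U"
proof -
  have "((\<lambda>p. x + fst p *\<^sub>R snd p) \<longlongrightarrow> x + 0 *\<^sub>R w) (at_right 0 \<times>\<^sub>F nhds w)"
    using filterlim_fst[of "at_right (0::real)" "nhds w"] filterlim_snd[of "nhds w" "at_right (0::real)"]
    by (intro tendsto_intros) (auto intro: filterlim_mono at_within_le_nhds)
  from topological_tendstoD[OF this assms(1)] assms(2) show ?thesis
    by (simp add: case_prod_unfold)
qed

lemma second_subderiv_ge_of_growth:
  assumes fin: "f x = ereal a" and U: "open U" "x \<in> U"
    and gr: "\<And>y. y \<in> U \<Longrightarrow> f y \<ge> f x + ereal (v \<bullet> (y - x) + C / 2 * (norm (y - x))\<^sup>2)"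
  shows "second_subderiv f x v w \<ge> ereal (C * (norm w)\<^sup>2)"
  unfolding second_subderiv_def
proof (rule le_Liminf_of_tendsto[where h = "\<lambda>p. C * (norm (snd p))\<^sup>2"])
  let ?FF = "at_right (0::real) \<times>\<^sub>F nhds w"
  show "?FF \<noteq> bot" by (rule second_subderiv_filter_nontrivial)
  show "((\<lambda>p. C * (norm (snd p))\<^sup>2) \<longlongrightarrow> C * (norm w)\<^sup>2) ?FF"
    by (intro tendsto_intros filterlim_snd)
  have "\<forall>\<^sub>F p in ?FF. 0 < fst p"
    by (rule eventually_compose_filterlim[OF eventually_at_right_less filterlim_fst])
  with eventually_segment_in_open[OF U, of w]
  show "\<forall>\<^sub>F p in ?FF. ereal (C * (norm (snd p))\<^sup>2) \<le> (case p of (t, u) \<Rightarrow> second_diff_quot f x v t u)"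
  proof eventually_elim
    case (elim p)
    obtain t u where p: "p = (t, u)" by (cases p)
    with elim have t: "t > 0" and "x + t *\<^sub>R u \<in> U" by simp_all
    from gr[OF this(2)] have lo: "f (x + t *\<^sub>R u) \<ge> ereal (a + (t * (v \<bullet> u) + t\<^sup>2 * (C / 2 * (norm u)\<^sup>2)))"
      by (simp add: fin power_mult_distrib mult_ac)
    have "ereal (C * (norm u)\<^sup>2) \<le> second_diff_quot f x v t u"
    proof (cases "f (x + t *\<^sub>R u)")
      case (real b)
      then have "C * (norm u)\<^sup>2 * (t\<^sup>2 / 2) \<le> b - a - t * (v \<bullet> u)" using lo by (simp add: mult_ac)
      then have "C * (norm u)\<^sup>2 \<le> (b - a - t * (v \<bullet> u)) / (t\<^sup>2 / 2)"
        using t by (subst pos_le_divide_eq) simp_all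
      then show ?thesis using real t by (simp add: second_diff_quot_def fin)
    next
      case PInf
      then show ?thesis using t by (simp add: second_diff_quot_def fin)
    next
      case MInf
      then show ?thesis using lo by simp
    qed
    then show ?case by (simp add: p)
  qed
qed

context local_prox
begin

lemma P_in_ball: "norm z < \<delta> \<Longrightarrow> P z \<in> ball xbar \<epsilon>"
  using P_near[of z] small_norm(1)[of z] by (simp add: dist_norm norm_minus_commute)

text \<open>Each direction \<open>y\<close> of the tilt supplies one Fenchel-Young bound, and its
  limit exists by \<open>g_quot_tendsto\<close>. The freedom in \<open>y\<close> is later used to
  optimize the bound.\<close>

lemma second_subderiv_lower:
  assumes z: "norm z < \<delta>" and lim: "((\<lambda>t. (P (z + t *\<^sub>R y) - P z) /\<^sub>R t) \<longlongrightarrow> a) (at_right 0)"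
  shows "second_subderiv f (P z) (z - \<mu> *\<^sub>R (P z - xbar)) w \<ge> ereal (2 * (y \<bullet> w) - a \<bullet> y - \<mu> * (norm w)\<^sup>2)"
  unfolding second_subderiv_def
proof (rule le_Liminf_of_tendsto[where h = "\<lambda>p. dual_quot z y (fst p) (snd p)"])
  let ?FF = "at_right (0::real) \<times>\<^sub>F nhds w"
  show "?FF \<noteq> bot" by (rule second_subderiv_filter_nontrivial)
  show "((\<lambda>p. dual_quot z y (fst p) (snd p)) \<longlongrightarrow> 2 * (y \<bullet> w) - a \<bullet> y - \<mu> * (norm w)\<^sup>2) ?FF"
    unfolding dual_quot_def
    by (intro tendsto_intros filterlim_snd filterlim_compose[OF g_quot_tendsto[OF z lim] filterlim_fst])
  have "\<forall>\<^sub>F p in ?FF. 0 < fst p \<and> norm (z + fst p *\<^sub>R y) < \<delta>"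
    using filterlim_fst[of "at_right (0::real)" "nhds w"]
      eventually_conj[OF eventually_at_right_less[of 0] eventually_small[OF z, of y]]
    by (rule eventually_compose_filterlim[rotated])
  with eventually_segment_in_open[OF open_ball P_in_ball[OF z], of w]
  show "\<forall>\<^sub>F p in ?FF. ereal (dual_quot z y (fst p) (snd p)) \<le>
      (case p of (t, u) \<Rightarrow> second_diff_quot f (P z) (z - \<mu> *\<^sub>R (P z - xbar)) t u)"
  proof eventually_elim
    case (elim p)
    obtain t u where p: "p = (t, u)" by (cases p)
    with elim have e: "P z + t *\<^sub>R u \<in> cball xbar \<epsilon>" "t > 0" "norm (z + t *\<^sub>R y) < \<delta>" by simp_all
    let ?w = "z + t *\<^sub>R y" and ?x = "P z + t *\<^sub>R u"
    have "F ?x \<ge> ereal (\<phi> ?w) + ereal (?w \<bullet> (?x - P ?w) + 1 / 2 * (norm (?x - P ?w))\<^sup>2)"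
      using P_growth[OF e(3,1)] F_P[OF e(3)] by simp
    moreover have "ereal (?w \<bullet> ?x - g ?w) \<le> ereal (\<phi> ?w) + ereal (?w \<bullet> (?x - P ?w) + 1 / 2 * (norm (?x - P ?w))\<^sup>2)"
      by (simp add: g_def inner_diff_right)
    ultimately have "F ?x \<ge> ereal (?w \<bullet> ?x - g ?w)" by (rule order_trans[rotated])
    from second_diff_quot_eq(1)[OF z e(2,3) refl this] show ?case by (simp add: p)
  qed
qed

definition P_quot :: "'a \<Rightarrow> 'a \<Rightarrow> real \<Rightarrow> 'a" where
  "P_quot z y t = (P (z + t *\<^sub>R y) - P z) /\<^sub>R t"

text \<open>Moving by \<open>t\<close> times this quotient leads from \<open>P z\<close> to
  \<open>P (z + t y)\<close>, where Fenchel-Young holds with equality.\<close>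

lemma second_diff_quot_recovery:
  assumes z: "norm z < \<delta>" and t: "t > 0" "norm (z + t *\<^sub>R y) < \<delta>"
  shows "second_diff_quot f (P z) (z - \<mu> *\<^sub>R (P z - xbar)) t (P_quot z y t)
    = ereal (dual_quot z y t (P_quot z y t))"
proof (rule second_diff_quot_eq(2)[OF z t refl])
  have "P z + t *\<^sub>R P_quot z y t = P (z + t *\<^sub>R y)" using t by (simp add: P_quot_def)
  then show "F (P z + t *\<^sub>R P_quot z y t) =
      ereal ((z + t *\<^sub>R y) \<bullet> (P z + t *\<^sub>R P_quot z y t) - g (z + t *\<^sub>R y))"
    by (simp add: F_P[OF t(2)] g_def)
qed

lemma dual_quot_tendsto:
  assumes z: "norm z < \<delta>" and lim: "(P_quot z y \<longlongrightarrow> a) (at_right 0)"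
  shows "((\<lambda>t. dual_quot z y t (P_quot z y t)) \<longlongrightarrow> y \<bullet> a - \<mu> * (norm a)\<^sup>2) (at_right 0)"
proof -
  have "((\<lambda>t. dual_quot z y t (P_quot z y t)) \<longlongrightarrow> 2 * (y \<bullet> a) - a \<bullet> y - \<mu> * (norm a)\<^sup>2) (at_right 0)"
    unfolding dual_quot_def using g_quot_tendsto[OF z lim[unfolded P_quot_def[abs_def]]]
    by (intro tendsto_intros lim)
  then show ?thesis by (simp add: inner_commute[of a y])
qed

text \<open>The quotients of \<open>P\<close> form a recovery family for the upper bound. The lower
  bound with the same \<open>y\<close> at \<open>w = a\<close> has the same value.\<close>

lemma second_subderiv_at:
  assumes z: "norm z < \<delta>" and lim: "(P_quot z y \<longlongrightarrow> a) (at_right 0)"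
  shows "second_subderiv f (P z) (z - \<mu> *\<^sub>R (P z - xbar)) a = ereal (y \<bullet> a - \<mu> * (norm a)\<^sup>2)"
proof (rule antisym)
  let ?q = "second_diff_quot f (P z) (z - \<mu> *\<^sub>R (P z - xbar))"
  have "filterlim (\<lambda>t. (t, P_quot z y t)) (at_right 0 \<times>\<^sub>F nhds a) (at_right 0)"
    by (intro filterlim_Pair lim filterlim_ident)
  from Liminf_le_along[OF this, of "\<lambda>(t, u). ?q t u"]
  have "second_subderiv f (P z) (z - \<mu> *\<^sub>R (P z - xbar)) a \<le> Liminf (at_right 0) (\<lambda>t. ?q t (P_quot z y t))"
    by (simp add: second_subderiv_def)
  also have "\<dots> \<le> Liminf (at_right 0) (\<lambda>t. ereal (dual_quot z y t (P_quot z y t)))"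
  proof (rule Liminf_mono)
    show "\<forall>\<^sub>F t in at_right 0. ?q t (P_quot z y t) \<le> ereal (dual_quot z y t (P_quot z y t))"
      using eventually_at_right_less[of 0] eventually_small[OF z, of y]
      by eventually_elim (simp add: second_diff_quot_recovery[OF z])
  qed
  also have "\<dots> = ereal (y \<bullet> a - \<mu> * (norm a)\<^sup>2)"
    by (intro lim_imp_Liminf tendsto_intros dual_quot_tendsto[OF z lim]) simp
  finally show "second_subderiv f (P z) (z - \<mu> *\<^sub>R (P z - xbar)) a \<le> ereal (y \<bullet> a - \<mu> * (norm a)\<^sup>2)" .
  show "ereal (y \<bullet> a - \<mu> * (norm a)\<^sup>2) \<le> second_subderiv f (P z) (z - \<mu> *\<^sub>R (P z - xbar)) a"
    using second_subderiv_lower[OF z lim[unfolded P_quot_def[abs_def]], of a] by (simp add: inner_commute[of a y])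
qed

section \<open>Points where the directional derivative of \<open>P\<close> is linear\<close>

context
  fixes z :: 'a and A :: "'a \<Rightarrow> 'a"
  assumes z: "norm z < \<delta>" and A: "linear A" and lim: "\<And>y. (P_quot z y \<longlongrightarrow> A y) (at_right 0)"
begin

abbreviation "d2 \<equiv> second_subderiv f (P z) (z - \<mu> *\<^sub>R (P z - xbar))"

lemma d2_lower: "ereal (2 * (y \<bullet> w) - A y \<bullet> y - \<mu> * (norm w)\<^sup>2) \<le> d2 w"
  using second_subderiv_lower[OF z lim[unfolded P_quot_def[abs_def]]] .

lemma d2_range: "d2 (A y) = ereal (y \<bullet> A y - \<mu> * (norm (A y))\<^sup>2)"
  using second_subderiv_at[OF z lim] .

text \<open>At \<open>A y\<close> the lower bounds hold for every tilt direction and are sharp for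
  \<open>y\<close> itself. Perturbing \<open>y\<close> by \<open>s q\<close> gives a linear term in
  \<open>s\<close> dominated by a quadratic one for all real \<open>s\<close>, so its coefficient
  \<open>D\<close>, the defect of symmetry, is 0.\<close>

lemma derivative_symmetric: "q \<bullet> A y = y \<bullet> A q"
proof (rule ccontr)
  define D where "D = q \<bullet> A y - A q \<bullet> y"
  define K where "K = A q \<bullet> q"
  assume "q \<bullet> A y \<noteq> y \<bullet> A q"
  then have D: "D \<noteq> 0" by (simp add: D_def inner_commute)
  have ineq: "s * D \<le> s\<^sup>2 * K" for s
  proof -
    have "2 * ((y + s *\<^sub>R q) \<bullet> A y) - A (y + s *\<^sub>R q) \<bullet> (y + s *\<^sub>R q) \<le> y \<bullet> A y"
      using d2_lower[of "y + s *\<^sub>R q" "A y"] unfolding d2_range by simp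
    then show ?thesis
      by (simp add: linear_add[OF A] linear_scale[OF A] D_def K_def inner_add_left inner_add_right
          inner_commute[of "A y"] algebra_simps power2_eq_square)
  qed
  \<comment> \<open>With this \<open>s\<close> the linear term equals
    \<open>\<bar>K\<bar> + 1\<close> times the square of \<open>s\<close>, which exceeds the
    quadratic term.\<close>
  define s where "s = D / (\<bar>K\<bar> + 1)"
  have "s * (\<bar>K\<bar> + 1) = D" unfolding s_def by (rule nonzero_eq_divide_eq[THEN iffD1]) auto
  then have "s * D = s\<^sup>2 * (\<bar>K\<bar> + 1)" by (simp add: power2_eq_square mult.assoc)
  moreover have "s\<^sup>2 * K \<le> s\<^sup>2 * \<bar>K\<bar>" by (intro mult_left_mono) auto
  moreover have "s\<^sup>2 > 0" using D by (simp add: s_def)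
  moreover have "s\<^sup>2 * (\<bar>K\<bar> + 1) = s\<^sup>2 * \<bar>K\<bar> + s\<^sup>2" by (simp add: distrib_left)
  ultimately show False using ineq[of s] by linarith
qed

text \<open>Let \<open>q\<close> be the nonzero component of \<open>w\<close> orthogonal to the
  range of \<open>A\<close>. For tilt directions \<open>s q\<close> the term with \<open>A\<close>
  vanishes and the remaining lower bound grows linearly in \<open>s\<close> without limit.\<close>

lemma d2_outside: "w \<notin> range A \<Longrightarrow> d2 w = \<infinity>"
proof -
  assume w: "w \<notin> range A"
  have sub: "subspace (range A)" using A by (simp add: linear_subspace_image)
  obtain p q where pq: "p \<in> range A" "\<And>u. u \<in> range A \<Longrightarrow> orthogonal q u" "w = p + q"
    using orthogonal_subspace_decomp_exists[of "range A" w] span_eq_iff[of "range A"] sub by metis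
  then have q: "q \<noteq> 0" using w by auto
  have lower: "ereal (2 * (s * (norm q)\<^sup>2) - \<mu> * (norm w)\<^sup>2) \<le> d2 w" for s
  proof -
    have "A (s *\<^sub>R q) \<bullet> q = 0" using pq(2)[of "A (s *\<^sub>R q)"] by (simp add: orthogonal_def inner_commute)
    moreover have "q \<bullet> w = (norm q)\<^sup>2"
      using pq(2)[OF pq(1)] by (simp add: pq(3) orthogonal_def inner_add_right power2_norm_eq_inner)
    ultimately show ?thesis using d2_lower[of "s *\<^sub>R q" w] by simp
  qed
  show "d2 w = \<infinity>"
  proof (rule ereal_top)
    fix B :: real
    have "2 * ((B + \<mu> * (norm w)\<^sup>2) / (2 * (norm q)\<^sup>2) * (norm q)\<^sup>2) = B + \<mu> * (norm w)\<^sup>2" using q by simp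
    then show "ereal B \<le> d2 w" using lower[of "(B + \<mu> * (norm w)\<^sup>2) / (2 * (norm q)\<^sup>2)"] by simp
  qed
qed

lemma effective_domain_d2: "effective_domain d2 = range A"
  using d2_outside d2_range by (force simp: effective_domain_def)

text \<open>With a linear right inverse \<open>B\<close> of \<open>A\<close> on its range, the value
  at \<open>w\<close> is the form of \<open>B - \<mu> I\<close>. Symmetry of \<open>B\<close> on the
  range is symmetry of \<open>A\<close> at preimages.\<close>

lemma gen_quadratic_form_d2: "gen_quadratic_form d2"
proof -
  obtain B where B: "linear B" "\<And>w. w \<in> range A \<Longrightarrow> A (B w) = w"
    using linear_exists_right_inverse_on[OF A subspace_UNIV] by auto
  define L where "L w = B w - \<mu> *\<^sub>R w" for w
  have sym: "B w \<bullet> w' = w \<bullet> B w'" if "w \<in> range A" "w' \<in> range A" for w w'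
    using derivative_symmetric[of "B w" "B w'"] B(2)[OF that(1)] B(2)[OF that(2)] by (simp add: inner_commute)
  have "d2 w \<noteq> -\<infinity>" for w using d2_lower[of 0 w] by auto
  then have "proper_fun d2" unfolding proper_fun_def effective_domain_d2 by blast
  moreover have "d2 w = ereal (L w \<bullet> w)" if "w \<in> range A" for w
    using d2_range[of "B w"] by (simp add: B(2)[OF that] L_def inner_diff_left power2_norm_eq_inner)
  moreover have "subspace (range A)" using A by (simp add: linear_subspace_image)
  moreover have "\<forall>w\<in>range A. \<forall>w'\<in>range A. L w \<bullet> w' = w \<bullet> L w'"
    using sym by (simp add: L_def inner_diff_left inner_diff_right)
  moreover have "L (w + w') = L w + L w'" "L (c *\<^sub>R w) = c *\<^sub>R L w" for w w' c
    using B(1) by (simp_all add: L_def linear_add linear_scale algebra_simps)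
  ultimately show ?thesis unfolding gen_quadratic_form_def effective_domain_d2 by blast
qed

lemma twice_epi_differentiable_P:
  "twice_epi_differentiable f (P z) (z - \<mu> *\<^sub>R (P z - xbar))"
proof (rule twice_epi_differentiableI)
  show "finite_at f (P z)" using f_finite[OF P_subgradient[OF z]] by (auto simp: finite_at_def)
  let ?q = "second_diff_quot f (P z) (z - \<mu> *\<^sub>R (P z - xbar))"
  show "epi d2 \<subseteq> inner_limit (\<lambda>t. epi (?q t))"
  proof
    fix e assume "e \<in> epi d2"
    then obtain w \<alpha> where e: "e = (w, \<alpha>)" "d2 w \<le> ereal \<alpha>" by (auto simp: epi_def)
    then have "w \<in> range A" using d2_outside[of w] by force
    then obtain y where y: "w = A y" by blast
    define c where "c t = dual_quot z y t (P_quot z y t)" for t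
    have c: "(c \<longlongrightarrow> y \<bullet> A y - \<mu> * (norm (A y))\<^sup>2) (at_right 0)"
      unfolding c_def[abs_def] by (rule dual_quot_tendsto[OF z lim])
    \<comment> \<open>Raising the height to \<open>max \<alpha> (c t)\<close> keeps the recovery
      pair in the epigraph and does not alter the limit, as \<open>\<alpha>\<close> is at least the
      limit of \<open>c\<close>.\<close>
    have "((\<lambda>t. max \<alpha> (c t)) \<longlongrightarrow> max \<alpha> (y \<bullet> A y - \<mu> * (norm (A y))\<^sup>2)) (at_right 0)"
      by (intro tendsto_max tendsto_const c)
    moreover have "max \<alpha> (y \<bullet> A y - \<mu> * (norm (A y))\<^sup>2) = \<alpha>" using e(2) by (simp add: y d2_range)
    ultimately have Zlim: "((\<lambda>t. (P_quot z y t, max \<alpha> (c t))) \<longlongrightarrow> e) (at_right 0)"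
      unfolding e(1) y by (intro tendsto_Pair lim) simp
    have Zepi: "\<forall>\<^sub>F t in at_right 0. (P_quot z y t, max \<alpha> (c t)) \<in> epi (?q t)"
      using eventually_at_right_less[of 0] eventually_small[OF z, of y]
      by eventually_elim (simp add: epi_def second_diff_quot_recovery[OF z] c_def)
    show "e \<in> inner_limit (\<lambda>t. epi (?q t))"
      unfolding inner_limit_def
    proof (intro CollectI allI impI)
      fix T assume T: "filterlim T (at_right (0::real)) sequentially"
      show "\<exists>Z. (\<forall>\<^sub>F k in sequentially. Z k \<in> epi (?q (T k))) \<and> Z \<longlonglongrightarrow> e"
        using eventually_compose_filterlim[OF Zepi T] filterlim_compose[OF Zlim T]
        by (intro exI[of _ "\<lambda>k. (P_quot z y (T k), max \<alpha> (c (T k)))"]) simp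
    qed
  qed
qed

end
end

section \<open>From the second subderivative to tilt stability\<close>

lemma tilt_argmin_eqI:
  fixes f :: "'a::euclidean_space \<Rightarrow> ereal"
  assumes fin: "f x = ereal a" and x: "x \<in> cball xbar \<gamma>" and C: "C > 0"
    and gr: "\<And>y. y \<in> cball xbar \<gamma> \<Longrightarrow> f y \<ge> f x + ereal (v \<bullet> (y - x) + C * (norm (y - x))\<^sup>2)"
  shows "tilt_argmin f xbar \<gamma> v = {x}"
proof -
  have h: "f y - ereal (v \<bullet> y) \<ge> ereal (a - v \<bullet> x + C * (norm (y - x))\<^sup>2)" if "y \<in> cball xbar \<gamma>" for y
    using gr[OF that] by (cases "f y") (simp_all add: fin inner_diff_right)
  have hx: "f x - ereal (v \<bullet> x) = ereal (a - v \<bullet> x)" by (simp add: fin)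
  show ?thesis
  proof (intro set_eqI iffI)
    fix y assume "y \<in> tilt_argmin f xbar \<gamma> v"
    then have y: "y \<in> cball xbar \<gamma>" "\<not> f x - ereal (v \<bullet> x) < f y - ereal (v \<bullet> y)"
      using x by (auto simp: tilt_argmin_def is_arg_min_def)
    then have "ereal (a - v \<bullet> x + C * (norm (y - x))\<^sup>2) \<le> ereal (a - v \<bullet> x)"
      using h[OF y(1)] hx by (metis not_less order_trans)
    then have "C * (norm (y - x))\<^sup>2 \<le> 0" by simp
    then show "y \<in> {x}" using C by (simp add: mult_le_0_iff)
  next
    fix y assume "y \<in> {x}"
    moreover have "\<not> f y - ereal (v \<bullet> y) < f x - ereal (v \<bullet> x)" if "y \<in> cball xbar \<gamma>" for y
    proof -
      have "ereal (a - v \<bullet> x) \<le> ereal (a - v \<bullet> x + C * (norm (y - x))\<^sup>2)" using C by simp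
      also have "\<dots> \<le> f y - ereal (v \<bullet> y)" by (rule h[OF that])
      finally show ?thesis by (simp add: hx)
    qed
    ultimately show "y \<in> tilt_argmin f xbar \<gamma> v" using x by (auto simp: tilt_argmin_def is_arg_min_def)
  qed
qed

context local_prox
begin

lemma f_growth_of_F_growth:
  assumes fin: "f x = ereal a"
    and gr: "F x' \<ge> F x + ereal (z \<bullet> (x' - x) + C * (norm (x' - x))\<^sup>2)"
  shows "f x' \<ge> f x + ereal ((z - \<mu> *\<^sub>R (x - xbar)) \<bullet> (x' - x) + (C - \<mu> / 2) * (norm (x' - x))\<^sup>2)"
proof -
  have e: "\<mu> / 2 * (norm (x' - xbar))\<^sup>2 = \<mu> / 2 * (norm (x - xbar))\<^sup>2 + \<mu> * ((x - xbar) \<bullet> (x' - x))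
      + \<mu> / 2 * (norm (x' - x))\<^sup>2"
    unfolding norm_sq_expand[of x' xbar x] by (simp add: field_simps)
  show ?thesis
    using gr unfolding F_def e
    by (cases "f x'") (simp_all add: fin inner_diff_left left_diff_distrib)
qed

lemma P_lipschitz_of_derivative_bound:
  assumes \<eta>: "\<eta> \<le> \<delta> / 2" and c: "c \<ge> 0"
    and bd: "\<And>z A y. \<lbrakk>norm z < \<eta>; linear A; \<And>y. (P_quot z y \<longlongrightarrow> A y) (at_right 0)\<rbrakk> \<Longrightarrow>
      norm (A y) \<le> c * norm y"
  shows "c-lipschitz_on (ball 0 \<eta>) P"
proof -
  \<comment> \<open>Rademacher's theorem is available for maps that are Lipschitz on the whole
    space. Composition with the projection onto a smaller ball extends \<open>P\<close> without
    enlarging its Lipschitz constant.\<close>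
  define p where "p z = P (closest_point (cball 0 (\<delta> / 2)) z)" for z
  have cb: "convex (cball (0::'a) (\<delta> / 2))" "closed (cball (0::'a) (\<delta> / 2))" "cball (0::'a) (\<delta> / 2) \<noteq> {}"
    using \<delta>_pos by auto
  have pl: "1-lipschitz_on UNIV p"
  proof (rule lipschitz_onI)
    fix z w :: 'a
    have "closest_point (cball 0 (\<delta> / 2)) u \<in> ball 0 \<delta>" for u :: 'a
      using closest_point_in_set[OF cb(2,3), of u] \<delta>_pos by simp
    then have "dist (p z) (p w) \<le> 1 * dist (closest_point (cball 0 (\<delta> / 2)) z) (closest_point (cball 0 (\<delta> / 2)) w)"
      unfolding p_def by (intro lipschitz_onD[OF P_lipschitz])
    also have "\<dots> \<le> dist z w" using closest_point_lipschitz[OF cb, of z w] by simp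
    finally show "dist (p z) (p w) \<le> 1 * dist z w" by simp
  qed simp
  have pP: "p z = P z" if "norm z < \<delta> / 2" for z
    unfolding p_def using that by (subst closest_point_self) auto
  have quot: "((\<lambda>s. (p (z + s *\<^sub>R y) - p z) /\<^sub>R s) \<longlongrightarrow> a) (at_right 0) \<longleftrightarrow> (P_quot z y \<longlongrightarrow> a) (at_right 0)"
    if "norm z < \<delta> / 2" for z y a
  proof (rule filterlim_cong[OF refl refl])
    have "((\<lambda>t. norm (z + t *\<^sub>R y)) \<longlongrightarrow> norm (z + 0 *\<^sub>R y)) (at_right 0)" by (intro tendsto_intros)
    then have "\<forall>\<^sub>F t in at_right 0. norm (z + t *\<^sub>R y) < \<delta> / 2" using that by (intro order_tendstoD(2)) auto
    then show "\<forall>\<^sub>F s in at_right 0. (p (z + s *\<^sub>R y) - p z) /\<^sub>R s = P_quot z y s"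
      by eventually_elim (simp only: P_quot_def pP that)
  qed
  have AE: "AE z in lborel. norm z < \<delta> / 2 \<longrightarrow> (\<exists>A. linear A \<and> (\<forall>y. (P_quot z y \<longlongrightarrow> A y) (at_right 0)))"
    using rademacher_gateaux[OF pl]
  proof eventually_elim
    case (elim z)
    then show ?case using quot[of z] by blast
  qed
  have "c-lipschitz_on (ball 0 \<eta>) p"
  proof (rule lipschitz_of_AE_dir_derivative_bound[OF pl open_ball convex_ball c])
    show "AE z in lborel. z \<in> ball 0 \<eta> \<longrightarrow>
      (\<forall>v. \<exists>l. ((\<lambda>s. (p (z + s *\<^sub>R v) - p z) /\<^sub>R s) \<longlongrightarrow> l) (at_right 0) \<and> norm l \<le> c * norm v)"
      using AE
    proof eventually_elim
      case (elim z)
      show ?case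
      proof
        assume "z \<in> ball 0 \<eta>"
        then have z: "norm z < \<eta>" "norm z < \<delta> / 2" using \<eta> by simp_all
        then obtain A where "linear A" "\<And>y. (P_quot z y \<longlongrightarrow> A y) (at_right 0)" using elim by blast
        then show "\<forall>v. \<exists>l. ((\<lambda>s. (p (z + s *\<^sub>R v) - p z) /\<^sub>R s) \<longlongrightarrow> l) (at_right 0) \<and> norm l \<le> c * norm v"
          using bd[OF z(1)] quot[OF z(2)] by blast
      qed
    qed
  qed
  moreover have "\<And>z. z \<in> ball 0 \<eta> \<Longrightarrow> p z = P z" using pP \<eta> by simp
  ultimately show "c-lipschitz_on (ball 0 \<eta>) P" by (auto simp: lipschitz_on_def)
qed

text \<open>The bound makes \<open>P\<close> Lipschitz with constant \<open>c\<close>, and conjugacy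
  turns this into growth of \<open>f\<close> around every nearby graph point. For each small
  \<open>v\<close> a minimizer over a small ball exists in its interior; growth makes it unique and
  Lipschitz in \<open>v\<close>.\<close>

lemma tilt_stable_of_d2_bound:
  assumes \<kappa>: "\<kappa> > 0" and \<eta>: "0 < \<eta>" "\<eta> \<le> \<delta> / 2"
    and bd: "\<And>z A w. \<lbrakk>norm z < \<eta>; linear A; \<And>y. (P_quot z y \<longlongrightarrow> A y) (at_right 0)\<rbrakk> \<Longrightarrow>
      second_subderiv f (P z) (z - \<mu> *\<^sub>R (P z - xbar)) w \<ge> ereal (1 / \<kappa> * (norm w)\<^sup>2)"
  shows "tilt_stable_minimizer f xbar \<kappa>"
proof -
  define c where "c = 1 / (\<mu> + 1 / \<kappa>)"
  have c: "c > 0" using \<mu> \<kappa> by (simp add: c_def add_pos_pos)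
  have half_c: "1 / (2 * c) - \<mu> / 2 = 1 / (2 * \<kappa>)" using \<kappa> by (simp add: c_def field_simps)
  have \<eta>\<delta>: "\<eta> < \<delta>" using \<eta> \<delta>_pos by simp
  have lip: "c-lipschitz_on (ball 0 \<eta>) P"
  proof (rule P_lipschitz_of_derivative_bound[OF \<eta>(2)])
    fix z A y assume z: "norm z < \<eta>" and A: "linear A" "\<And>y. (P_quot z y \<longlongrightarrow> A y) (at_right 0)"
    have "ereal (1 / \<kappa> * (norm (A y))\<^sup>2) \<le> ereal (y \<bullet> A y - \<mu> * (norm (A y))\<^sup>2)"
      using bd[OF z A, of "A y"] second_subderiv_at[OF _ A(2)] z \<eta>\<delta> by simp
    then have "(\<mu> + 1 / \<kappa>) * norm (A y) * norm (A y) \<le> y \<bullet> A y"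
      by (simp add: power2_eq_square algebra_simps)
    also have "\<dots> \<le> norm y * norm (A y)" by (rule norm_cauchy_schwarz)
    finally have "(\<mu> + 1 / \<kappa>) * norm (A y) \<le> norm y" by (cases "A y = 0") auto
    moreover have "\<mu> + 1 / \<kappa> > 0" using \<mu> \<kappa> by (simp add: add_pos_pos)
    ultimately show "norm (A y) \<le> c * norm y" by (simp add: c_def field_simps)
  qed (use c in simp)
  \<comment> \<open>Both the parameter \<open>v + \<mu> (x - xbar)\<close> and its dual displacement
    by \<open>(x' - x) / c\<close> have to stay in the ball of radius \<open>\<eta>\<close>. Here
    \<open>norm (x' - x)\<close> is at most \<open>2 * \<gamma>\<close>; one half of
    \<open>\<eta>\<close> is spent on this and the other on \<open>v\<close>. The bound
    \<open>\<gamma> / (2 * \<kappa>)\<close> for \<open>\<rho>\<close> keeps minimizers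
    interior.\<close>
  define \<gamma> where "\<gamma> = min \<epsilon> (\<eta> / 2 / (\<mu> + 2 / c))"
  define \<rho> where "\<rho> = min (\<eta> / 2) (\<gamma> / (2 * \<kappa>))"
  have mc: "\<mu> + 2 / c > 0" using \<mu> c by (simp add: add_pos_pos)
  have \<gamma>: "\<gamma> > 0" "\<gamma> \<le> \<epsilon>" "(\<mu> + 2 / c) * \<gamma> \<le> \<eta> / 2"
  proof -
    show "\<gamma> > 0" using \<epsilon> \<eta> mc by (simp add: \<gamma>_def)
    show "\<gamma> \<le> \<epsilon>" by (simp add: \<gamma>_def)
    have "(\<mu> + 2 / c) * \<gamma> \<le> (\<mu> + 2 / c) * (\<eta> / 2 / (\<mu> + 2 / c))"
      using mc by (intro mult_left_mono) (auto simp: \<gamma>_def)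
    also have "\<dots> = \<eta> / 2"
    proof -
      have "K * (b / K) = b" if "K > 0" for K b :: real using that by simp
      then show ?thesis using mc by blast
    qed
    finally show "(\<mu> + 2 / c) * \<gamma> \<le> \<eta> / 2" .
  qed
  have \<rho>: "\<rho> > 0" "\<rho> \<le> \<eta> / 2" "2 * \<kappa> * \<rho> \<le> \<gamma>"
  proof -
    show "\<rho> > 0" using \<gamma> \<eta> \<kappa> by (simp add: \<rho>_def)
    show "\<rho> \<le> \<eta> / 2" by (simp add: \<rho>_def)
    have "2 * \<kappa> * \<rho> \<le> 2 * \<kappa> * (\<gamma> / (2 * \<kappa>))" using \<kappa> by (intro mult_left_mono) (auto simp: \<rho>_def)
    then show "2 * \<kappa> * \<rho> \<le> \<gamma>" using \<kappa> by simp
  qed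
  have \<delta>\<epsilon>: "\<delta> \<le> \<epsilon>" using \<mu> \<epsilon> by (simp add: \<delta>_def field_simps)
  have growth: "f x' \<ge> f x + ereal (v \<bullet> (x' - x) + 1 / (2 * \<kappa>) * (norm (x' - x))\<^sup>2)"
    if v: "v \<in> limiting_subdiff f x" "norm v < \<rho>" and x: "x \<in> cball xbar \<gamma>" "x' \<in> cball xbar \<gamma>" for v x x'
  proof -
    define z where "z = v + \<mu> *\<^sub>R (x - xbar)"
    have nx: "norm (x - xbar) \<le> \<gamma>" "norm (x' - xbar) \<le> \<gamma>"
      using x by (simp_all add: dist_norm norm_minus_commute)
    have "norm (x' - x) \<le> 2 * \<gamma>" using norm_triangle_ineq4[of "x' - xbar" "x - xbar"] nx by simp
    then have dx: "norm ((x' - x) /\<^sub>R c) \<le> 2 / c * \<gamma>" using c by (simp add: divide_simps)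
    have "norm z \<le> norm v + \<mu> * norm (x - xbar)"
      using norm_triangle_ineq[of v "\<mu> *\<^sub>R (x - xbar)"] \<mu> by (simp add: z_def)
    also have "\<dots> \<le> norm v + \<mu> * \<gamma>" using nx \<mu> by (intro add_left_mono mult_left_mono) auto
    finally have nz: "norm z \<le> norm v + \<mu> * \<gamma>" .
    have sum: "norm v + \<mu> * \<gamma> + 2 / c * \<gamma> < \<eta>"
      using v(2) \<rho>(2) \<gamma>(3) by (simp add: distrib_right)
    have c\<gamma>: "2 / c * \<gamma> > 0" using c \<gamma> by simp
    have z\<eta>: "norm z < \<eta>" using nz sum c\<gamma> by linarith
    have zx: "norm (z + (x' - x) /\<^sub>R c) < \<eta>"
      using norm_triangle_ineq[of z "(x' - x) /\<^sub>R c"] nz dx sum by linarith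
    have Pz: "P z = x"
      unfolding z_def
      by (rule P_unique[OF v(1)])
        (use nx \<gamma> v(2) \<rho> \<eta>\<delta> \<delta>\<epsilon> \<eta> z\<eta> in \<open>auto simp: z_def\<close>)
    obtain a where a: "f x = ereal a" using f_finite[OF v(1)] by blast
    have "F x' \<ge> F (P z) + ereal (z \<bullet> (x' - P z) + 1 / (2 * c) * (norm (x' - P z))\<^sup>2)"
    proof (rule quadratic_growth_of_lipschitz_argmin[where U = "ball 0 \<eta>" and S = "cball xbar \<epsilon>" and \<phi> = \<phi>, OF open_ball convex_ball c lip])
      show "F x \<ge> F (P v) + ereal (v \<bullet> (x - P v))" if "v \<in> ball 0 \<eta>" "x \<in> cball xbar \<epsilon>" for v x
      proof -
        have v: "norm v < \<delta>" using that \<eta>\<delta> by simp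
        have "F (P v) + ereal (v \<bullet> (x - P v)) \<le> F (P v) + ereal (v \<bullet> (x - P v) + 1 / 2 * (norm (x - P v))\<^sup>2)"
          by (intro add_left_mono) simp
        also have "\<dots> \<le> F x" by (rule P_growth[OF v that(2)])
        finally show ?thesis .
      qed
    qed (use F_P P_in_cball \<eta>\<delta> z\<eta> zx x \<gamma> in \<open>auto simp: Pz\<close>)
    from f_growth_of_F_growth[OF a this[unfolded Pz]] show ?thesis
      by (simp add: half_c) (simp add: z_def)
  qed
  have ex: "\<exists>x. x \<in> cball xbar \<gamma> \<and> v \<in> limiting_subdiff f x" if v: "norm v < \<rho>" for v
  proof -
    have v1: "norm v \<le> 1" using v \<rho> \<eta> \<delta>\<epsilon> \<epsilon> \<delta>_pos by linarith
    have sub: "x \<in> cball xbar \<epsilon>" if "x \<in> cball xbar \<gamma>" for x using that \<gamma> by simp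
    have "\<exists>x\<in>cball xbar \<gamma>. \<forall>y\<in>cball xbar \<gamma>. f x + ereal (- (v \<bullet> x)) \<le> f y + ereal (- (v \<bullet> y))"
    proof (rule perturbed_minimum_exists[where ?F0.0 = F0 and \<epsilon> = \<epsilon> and B = "F0 - r / 2 * \<epsilon>\<^sup>2"])
      show "continuous_on (cball xbar \<gamma>) (\<lambda>y. - (v \<bullet> y))" by (intro continuous_intros)
      show "closed {x \<in> cball xbar \<gamma>. f x \<le> ereal \<alpha>}" if "\<alpha> \<le> F0 + \<epsilon>" for \<alpha>
      proof -
        have "{x \<in> cball xbar \<gamma>. f x \<le> ereal \<alpha>} = cball xbar \<gamma> \<inter> {x \<in> cball xbar \<epsilon>. f x \<le> ereal \<alpha>}"
          using sub by blast
        then show ?thesis using lsc[OF that] closed_Int[OF closed_cball] by metis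
      qed
      fix x assume x: "x \<in> cball xbar \<gamma>"
      then have n: "norm (x - xbar) \<le> \<epsilon>" using sub by (simp add: dist_norm norm_minus_commute)
      then have "(norm (x - xbar))\<^sup>2 \<le> \<epsilon>\<^sup>2" by (intro power_mono) auto
      then have "F0 - r / 2 * \<epsilon>\<^sup>2 \<le> F0 - r / 2 * (norm (x - xbar))\<^sup>2"
        using r by (simp add: mult_left_mono)
      then show "ereal (F0 - r / 2 * \<epsilon>\<^sup>2) \<le> f x"
        using f_lower[OF sub[OF x]] by (meson ereal_less_eq(3) order_trans)
      have "v \<bullet> (x - xbar) \<le> norm v * norm (x - xbar)" by (rule norm_cauchy_schwarz)
      also have "\<dots> \<le> 1 * \<epsilon>" using n v1 by (intro mult_mono) auto
      finally show "- (v \<bullet> xbar) - - (v \<bullet> x) \<le> \<epsilon>" by (simp add: inner_diff_right)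
    qed (use \<gamma> in \<open>simp_all add: f_xbar\<close>)
    then obtain x where x: "x \<in> cball xbar \<gamma>"
      and min: "\<And>y. y \<in> cball xbar \<gamma> \<Longrightarrow> f x + ereal (- (v \<bullet> x)) \<le> f y + ereal (- (v \<bullet> y))" by blast
    have mx: "f x + ereal (- (v \<bullet> x)) \<le> ereal (F0 - v \<bullet> xbar)" using min[of xbar] \<gamma> by (simp add: f_xbar)
    then obtain a where a: "f x = ereal a" using f_lower[OF sub[OF x]] by (cases "f x") auto
    define d where "d = norm (x - xbar)"
    \<comment> \<open>Growth at \<open>xbar\<close> with subgradient 0, compared with minimality of
      \<open>x\<close>, bounds the distance to \<open>xbar\<close> by
      \<open>2 * \<kappa> * norm v\<close>, which is less than \<open>\<gamma>\<close>. So
      \<open>v\<close> is a subgradient at an interior minimizer.\<close>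
    have "F0 + 1 / (2 * \<kappa>) * d\<^sup>2 \<le> a"
      using growth[OF zero_sub _ _ x] \<rho> \<gamma> by (simp add: a f_xbar d_def)
    moreover have "a - v \<bullet> x \<le> F0 - v \<bullet> xbar" using mx by (simp add: a)
    ultimately have "1 / (2 * \<kappa>) * d\<^sup>2 \<le> v \<bullet> (x - xbar)" by (simp add: inner_diff_right)
    also have "\<dots> \<le> norm v * d" unfolding d_def by (rule norm_cauchy_schwarz)
    finally have "d * d \<le> (2 * \<kappa> * norm v) * d" using \<kappa> by (simp add: power2_eq_square field_simps)
    then have "d \<le> 2 * \<kappa> * norm v" using \<kappa> by (cases "d = 0") (auto simp: d_def)
    also have "\<dots> < 2 * \<kappa> * \<rho>" using v \<kappa> by simp
    finally have d: "d < \<gamma>" using \<rho>(3) by simp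
    have "v \<in> regular_subdiff f x"
    proof (rule regular_subdiffI[where C = 0])
      show "finite_at f x" by (simp add: finite_at_def a)
      show "0 < \<gamma> - d" using d by simp
      fix y assume "norm (y - x) < \<gamma> - d"
      then have "y \<in> cball xbar \<gamma>"
        unfolding d_def mem_cball dist_norm using norm_triangle_ineq[of "y - x" "x - xbar"]
        by (simp add: norm_minus_commute)
      from min[OF this] show "f y \<ge> f x + ereal (v \<bullet> (y - x) - 0 * (norm (y - x))\<^sup>2)"
        by (cases "f y") (simp_all add: a inner_diff_right)
    qed
    then show ?thesis using x regular_subset_limiting_subdiff by blast
  qed
  define m where "m v = (SOME x. x \<in> cball xbar \<gamma> \<and> v \<in> limiting_subdiff f x)" for v
  have m: "m v \<in> cball xbar \<gamma>" "v \<in> limiting_subdiff f (m v)" if "norm v < \<rho>" for v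
    using someI_ex[OF ex[OF that]] unfolding m_def by blast+
  have argmin: "tilt_argmin f xbar \<gamma> v = {x}"
    if v: "norm v < \<rho>" and x: "x \<in> cball xbar \<gamma>" "v \<in> limiting_subdiff f x" for v x
  proof -
    obtain a where "f x = ereal a" using f_finite[OF x(2)] by blast
    then show ?thesis
      by (rule tilt_argmin_eqI[OF _ x(1) _ growth[OF x(2) v x(1)]]) (use \<kappa> in auto)
  qed
  have "\<kappa>-lipschitz_on (ball 0 \<rho>) m"
  proof (rule lipschitz_onI)
    fix v w :: 'a assume "v \<in> ball 0 \<rho>" "w \<in> ball 0 \<rho>"
    then have vw: "norm v < \<rho>" "norm w < \<rho>" by simp_all
    obtain a b where ab: "f (m v) = ereal a" "f (m w) = ereal b"
      using f_finite[OF m(2)[OF vw(1)]] f_finite[OF m(2)[OF vw(2)]] by blast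
    have "2 * (1 / (2 * \<kappa>)) * norm (m v - m w) \<le> norm (v - w)"
      by (rule growth_expansive[OF ab growth[OF m(2)[OF vw(1)] vw(1) m(1)[OF vw(1)] m(1)[OF vw(2)]]
          growth[OF m(2)[OF vw(2)] vw(2) m(1)[OF vw(2)] m(1)[OF vw(1)]]])
    then show "dist (m v) (m w) \<le> \<kappa> * dist v w" using \<kappa> by (simp add: dist_norm field_simps)
  qed (use \<kappa> in simp)
  moreover have "\<forall>v\<in>ball 0 \<rho>. tilt_argmin f xbar \<gamma> v = {m v}" using argmin m by simp
  moreover have "tilt_argmin f xbar \<gamma> 0 = {xbar}" using argmin[OF _ _ zero_sub] \<rho> \<gamma> by simp
  moreover have "finite_at f xbar" by (simp add: finite_at_def f_xbar)
  ultimately show ?thesis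
    unfolding tilt_stable_minimizer_def using \<gamma>(1) \<rho>(1)
    by (intro conjI exI[of _ \<gamma>] exI[of _ "ball 0 \<rho>"] exI[of _ m]) auto
qed

end

section \<open>From tilt stability to the second subderivative\<close>

context local_prox
begin

text \<open>The bound is obtained at every nearby graph point, whatever the form of the second
  subderivative there, so it yields (b) and (c) together.\<close>

lemma second_subderiv_ge_of_tilt_stable:
  assumes tilt: "tilt_stable_minimizer f xbar \<kappa>" and \<kappa>: "\<kappa> > 0"
  shows "\<exists>\<eta>>0. \<forall>x v w. v \<in> limiting_subdiff f x \<and> norm (x - xbar) \<le> \<eta> \<and> norm v \<le> \<eta> \<longrightarrow>
    second_subderiv f x v w \<ge> ereal (1 / \<kappa> * (norm w)\<^sup>2)"
proof -
  obtain \<gamma> V m where \<gamma>: "\<gamma> > 0" and arg0: "tilt_argmin f xbar \<gamma> 0 = {xbar}"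
    and V: "open V" "0 \<in> V" and arg: "\<And>v. v \<in> V \<Longrightarrow> tilt_argmin f xbar \<gamma> v = {m v}"
    and lipV: "\<kappa>-lipschitz_on V m"
    using tilt unfolding tilt_stable_minimizer_def by blast
  obtain \<rho>1 where \<rho>1: "\<rho>1 > 0" "ball 0 \<rho>1 \<subseteq> V" using V open_contains_ball by blast
  have m0: "m 0 = xbar" using arg[OF V(2)] arg0 by simp
  \<comment> \<open>Since \<open>norm (m v - xbar)\<close> is at most
    \<open>\<kappa> * norm v\<close>, these bounds keep \<open>m v\<close> inside the balls of
    radius \<open>\<gamma>\<close> and \<open>\<epsilon>\<close>, and the parameter
    \<open>v + \<mu> (m v - xbar)\<close> inside the domain of \<open>P\<close>.\<close>
  have "\<exists>\<rho>>0. \<rho> \<le> \<rho>1 \<and> \<rho> \<le> \<epsilon> \<and> \<kappa> * \<rho> \<le> \<epsilon> \<and> \<kappa> * \<rho> \<le> \<gamma> \<and> (1 + \<mu> * \<kappa>) * \<rho> \<le> \<delta>"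
  proof -
    have "1 + \<mu> * \<kappa> > 0" using \<mu> \<kappa> by (simp add: add_pos_pos)
    moreover have "k * \<rho> \<le> b" if "\<rho> \<le> b / k" "k > 0" for k b \<rho> :: real
      using that by (simp add: pos_le_divide_eq mult.commute)
    moreover define \<rho> where "\<rho> = Min {\<rho>1, \<epsilon>, \<epsilon> / \<kappa>, \<gamma> / \<kappa>, \<delta> / (1 + \<mu> * \<kappa>)}"
    moreover have "\<rho> > 0" using \<open>1 + \<mu> * \<kappa> > 0\<close> \<rho>1(1) \<epsilon>(1) \<gamma> \<kappa> \<delta>_pos by (simp add: \<rho>_def)
    moreover have "\<rho> \<le> \<rho>1" "\<rho> \<le> \<epsilon>" "\<rho> \<le> \<epsilon> / \<kappa>" "\<rho> \<le> \<gamma> / \<kappa>" "\<rho> \<le> \<delta> / (1 + \<mu> * \<kappa>)"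
      by (simp_all add: \<rho>_def)
    ultimately show ?thesis using \<kappa> by blast
  qed
  then obtain \<rho> where \<rho>: "\<rho> > 0" "\<rho> \<le> \<rho>1" "\<rho> \<le> \<epsilon>" "\<kappa> * \<rho> \<le> \<epsilon>" "\<kappa> * \<rho> \<le> \<gamma>" "(1 + \<mu> * \<kappa>) * \<rho> \<le> \<delta>"
    by blast
  have inV: "v \<in> V" if "norm v < \<rho>" for v using that \<rho>(2) \<rho>1(2) by auto
  have lip: "\<kappa>-lipschitz_on (ball 0 \<rho>) m" by (rule lipschitz_on_subset[OF lipV]) (use inV in auto)
  have mn: "norm (m v - xbar) \<le> \<kappa> * norm v" if "norm v < \<rho>" for v
    using lipschitz_onD[OF lipV inV[OF that] V(2)] by (simp add: m0 dist_norm)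
  have mn': "norm (m v - xbar) < \<kappa> * \<rho>" if "norm v < \<rho>" for v
    using mn[OF that] mult_strict_left_mono[OF that \<kappa>] by linarith
  have in_arg: "m v \<in> cball xbar \<gamma> \<and> (\<forall>y\<in>cball xbar \<gamma>. f (m v) - ereal (v \<bullet> m v) \<le> f y - ereal (v \<bullet> y))"
    if "norm v < \<rho>" for v
  proof -
    have "m v \<in> tilt_argmin f xbar \<gamma> v" using arg[OF inV[OF that]] by simp
    then show ?thesis unfolding tilt_argmin_def is_arg_min_def mem_Collect_eq not_ex de_Morgan_conj not_less by blast
  qed
  have f_ge: "f y \<ge> ereal F0" if "y \<in> cball xbar \<gamma>" for y
    using in_arg[of 0] \<rho>(1) that by (simp add: m0 f_xbar zero_ereal_def[symmetric])
  define \<psi> where "\<psi> v = real_of_ereal (f (m v))" for v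
  have fin: "f (m v) = ereal (\<psi> v)" if "norm v < \<rho>" for v
  proof -
    have "f (m v) - ereal (v \<bullet> m v) \<le> ereal (F0 - v \<bullet> xbar)" 
      using bspec[OF conjunct2[OF in_arg[OF that]], of xbar] \<gamma> by (simp add: f_xbar)
    moreover have "f (m v) \<ge> ereal F0" using f_ge in_arg[OF that] by blast
    ultimately show ?thesis by (cases "f (m v)") (auto simp: \<psi>_def)
  qed
  have min: "f y \<ge> f (m v) + ereal (v \<bullet> (y - m v))" if "norm v < \<rho>" "y \<in> cball xbar \<gamma>" for v y
  proof -
    have "f (m v) - ereal (v \<bullet> m v) \<le> f y - ereal (v \<bullet> y)" using in_arg[OF that(1)] that(2) by blast
    then show ?thesis by (cases "f y") (simp_all add: fin[OF that(1)] inner_diff_right)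
  qed
  have sub: "v \<in> limiting_subdiff f (m v)" if v: "norm v < \<rho>" for v
  proof -
    have "v \<in> regular_subdiff f (m v)"
    proof (rule regular_subdiffI[where C = 0])
      show "finite_at f (m v)" by (simp add: finite_at_def fin[OF v])
      show "0 < \<gamma> - norm (m v - xbar)" using mn'[OF v] \<rho>(5) by linarith
      fix y assume "norm (y - m v) < \<gamma> - norm (m v - xbar)"
      then have "y \<in> cball xbar \<gamma>"
        unfolding mem_cball dist_norm using norm_triangle_ineq[of "y - m v" "m v - xbar"]
        by (simp add: norm_minus_commute)
      from min[OF v this] show "f y \<ge> f (m v) + ereal (v \<bullet> (y - m v) - 0 * (norm (y - m v))\<^sup>2)" by simp
    qed
    then show ?thesis using regular_subset_limiting_subdiff by blast
  qed
  define S where "S v = v + \<mu> *\<^sub>R (m v - xbar)" for v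
  have PS: "P (S v) = m v" if v: "norm v < \<rho>" for v
    unfolding S_def
  proof (rule P_unique[OF sub[OF v]])
    show "norm (m v - xbar) \<le> \<epsilon>" "norm v \<le> \<epsilon>" using mn'[OF v] \<rho> v by linarith+
    have "norm (v + \<mu> *\<^sub>R (m v - xbar)) \<le> norm v + \<mu> * norm (m v - xbar)"
      using norm_triangle_ineq[of v "\<mu> *\<^sub>R (m v - xbar)"] \<mu> by simp
    also have "\<dots> \<le> norm v + \<mu> * (\<kappa> * norm v)"
      using mn[OF v] \<mu> by (intro add_left_mono mult_left_mono) auto
    also have "\<dots> = (1 + \<mu> * \<kappa>) * norm v" by (simp add: algebra_simps)
    also have "\<dots> < (1 + \<mu> * \<kappa>) * \<rho>" using v \<mu> \<kappa> by (intro mult_strict_left_mono) (auto simp: add_pos_pos)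
    finally show "norm (v + \<mu> *\<^sub>R (m v - xbar)) < \<delta>" using \<rho>(6) by linarith
  qed
  \<comment> \<open>It must be excluded that the graph has nearby points other than
    \<open>(m v, v)\<close>. \<open>S\<close> is injective because \<open>P\<close> recovers
    \<open>m v\<close> from \<open>S v\<close>; openness of its image then shows that all parameters
    near 0 come from the argmin map.\<close>
  have "open (S ` ball 0 \<rho>)"
  proof (rule invariance_of_domain[OF _ open_ball])
    show "continuous_on (ball 0 \<rho>) S"
      unfolding S_def by (intro continuous_intros lipschitz_on_continuous_on[OF lip])
    show "inj_on S (ball 0 \<rho>)"
    proof (rule inj_onI)
      fix v w assume vw: "v \<in> ball 0 \<rho>" "w \<in> ball 0 \<rho>" "S v = S w"
      then have "m v = m w" using PS[of v] PS[of w] by simp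
      then show "v = w" using vw(3) by (simp add: S_def)
    qed
  qed
  moreover have "0 \<in> S ` ball 0 \<rho>" using \<rho>(1) by (intro image_eqI[of _ _ 0]) (auto simp: S_def m0)
  ultimately obtain \<rho>' where \<rho>': "\<rho>' > 0" "ball 0 \<rho>' \<subseteq> S ` ball 0 \<rho>"
    using open_contains_ball by blast
  \<comment> \<open>The parameter of a graph point within \<open>\<eta>\<close> has norm at most
    \<open>(1 + \<mu>) * \<eta>\<close>, which has to lie below both \<open>\<rho>'\<close> and
    \<open>\<delta>\<close>.\<close>
  define \<eta> where "\<eta> = min \<epsilon> (min \<rho>' \<delta> / (2 * (1 + \<mu>)))"
  have \<eta>: "\<eta> > 0" "\<eta> \<le> \<epsilon>" "(1 + \<mu>) * \<eta> < min \<rho>' \<delta>"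
  proof -
    show "\<eta> > 0" using \<epsilon> \<mu> \<rho>' \<delta>_pos by (simp add: \<eta>_def)
    show "\<eta> \<le> \<epsilon>" by (simp add: \<eta>_def)
    have "(1 + \<mu>) * \<eta> \<le> (1 + \<mu>) * (min \<rho>' \<delta> / (2 * (1 + \<mu>)))"
      using \<mu> by (intro mult_left_mono) (auto simp: \<eta>_def)
    also have "\<dots> = min \<rho>' \<delta> / 2" using \<mu> by (simp add: field_simps)
    also have "\<dots> < min \<rho>' \<delta>" using \<rho>'(1) \<delta>_pos by (simp add: min_def)
    finally show "(1 + \<mu>) * \<eta> < min \<rho>' \<delta>" .
  qed
  have "second_subderiv f x v w \<ge> ereal (1 / \<kappa> * (norm w)\<^sup>2)"
    if x: "v \<in> limiting_subdiff f x" "norm (x - xbar) \<le> \<eta>" "norm v \<le> \<eta>" for x v w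
  proof -
    define z where "z = v + \<mu> *\<^sub>R (x - xbar)"
    have "norm z \<le> norm v + \<mu> * norm (x - xbar)"
      using norm_triangle_ineq[of v "\<mu> *\<^sub>R (x - xbar)"] \<mu> by (simp add: z_def)
    also have "\<dots> \<le> \<eta> + \<mu> * \<eta>" using x \<mu> by (intro add_mono mult_left_mono) auto
    finally have z: "norm z < \<rho>'" "norm z < \<delta>" using \<eta>(3) by (simp_all add: distrib_right)
    then obtain v' where v': "norm v' < \<rho>" "z = S v'" using \<rho>'(2) by auto
    have "P z = x" unfolding z_def by (rule P_unique[OF x(1)]) (use x \<eta> z in \<open>auto simp: z_def\<close>)
    then have xm: "x = m v'" using PS[OF v'(1)] v'(2) by simp
    then have vv: "v = v'" using v'(2) by (simp add: z_def S_def)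
    have v: "norm v < \<rho>" and xmv: "x = m v" using v'(1) xm vv by simp_all
    \<comment> \<open>The points whose dual point \<open>v + (y - x) / \<kappa>\<close> is still an
      admissible tilt; local growth around \<open>x\<close> suffices for the second
      subderivative.\<close>
    define U where "U = ball xbar \<gamma> \<inter> {y. norm (v + (y - x) /\<^sub>R \<kappa>) < \<rho>}"
    have "open U" unfolding U_def by (intro open_Int open_ball open_Collect_less continuous_intros)
    moreover have "x \<in> U"
      using mn'[OF v] \<rho>(5) v by (simp add: U_def xmv dist_norm norm_minus_commute)
    moreover have "f y \<ge> f x + ereal (v \<bullet> (y - x) + 1 / \<kappa> / 2 * (norm (y - x))\<^sup>2)" if "y \<in> U" for y
    proof -
      have "f y \<ge> f (m v) + ereal (v \<bullet> (y - m v) + 1 / (2 * \<kappa>) * (norm (y - m v))\<^sup>2)"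
        by (rule quadratic_growth_of_lipschitz_argmin[where U = "ball 0 \<rho>" and S = "cball xbar \<gamma>" and \<phi> = \<psi>,
              OF open_ball convex_ball \<kappa> lip])
          (use fin in_arg min v that in \<open>auto simp: U_def xmv\<close>)
      then show ?thesis by (simp add: xmv mult.commute)
    qed
    moreover have "f x = ereal (\<psi> v)" using fin[OF v] xmv by simp
    ultimately show ?thesis by (intro second_subderiv_ge_of_growth)
  qed
  then show ?thesis using \<eta>(1) by blast
qed

end

section \<open>The equivalence\<close>

lemma Pair_mem_cballI:
  assumes "norm (x - xbar) + norm v \<le> \<eta>"
  shows "(x, v) \<in> cball (xbar, 0) \<eta>"
proof -
  have "dist (xbar, 0) (x, v) \<le> dist xbar x + dist 0 v"
    unfolding dist_Pair_Pair by (rule sqrt_sum_squares_le_sum) auto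
  then show ?thesis using assms by (simp add: dist_norm norm_minus_commute)
qed

lemma Pair_mem_cballD:
  assumes "(x, v) \<in> cball (xbar, 0) \<eta>"
  shows "norm (x - xbar) \<le> \<eta>" "norm v \<le> \<eta>"
  using assms dist_fst_le[of "(xbar, 0)" "(x, v)"] dist_snd_le[of "(xbar, 0)" "(x, v)"]
  by (simp_all add: dist_norm norm_minus_commute)

context local_prox
begin

text \<open>The bound is assumed only where \<open>f\<close> is twice epi-differentiable and the
  second subderivative is a generalized quadratic form. Hence this covers the implications from (b)
  and from (c) at once.\<close>

lemma tilt_stable_of_generic_bound:
  assumes \<kappa>: "\<kappa> > 0" and \<eta>: "\<eta> > 0"
    and bd: "\<And>x v w. \<lbrakk>(x, v) \<in> gph_subdiff f \<inter> cball (xbar, 0) \<eta>; twice_epi_differentiable f x v;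
        gen_quadratic_form (second_subderiv f x v)\<rbrakk> \<Longrightarrow> second_subderiv f x v w \<ge> ereal (1 / \<kappa> * (norm w)\<^sup>2)"
  shows "tilt_stable_minimizer f xbar \<kappa>"
proof (rule tilt_stable_of_d2_bound[OF \<kappa>])
  \<comment> \<open>The factor adds the two bounds \<open>2 * norm z\<close> for the point and
    \<open>(2 * \<mu> + 1) * norm z\<close> for the subgradient.\<close>
  let ?\<eta> = "min (\<delta> / 2) (\<eta> / (2 * \<mu> + 3))"
  show "0 < ?\<eta>" using \<delta>_pos \<eta> \<mu> by simp
  show "?\<eta> \<le> \<delta> / 2" by (rule min.cobounded1)
  fix z A w assume z: "norm z < ?\<eta>" and A: "linear A" "\<And>y. (P_quot z y \<longlongrightarrow> A y) (at_right 0)"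
  have z\<delta>: "norm z < \<delta>" using z \<delta>_pos by simp
  have "(2 * \<mu> + 3) * norm z \<le> \<eta>" using z \<mu> by (simp add: pos_less_divide_eq mult.commute)
  then have "norm (P z - xbar) + norm (z - \<mu> *\<^sub>R (P z - xbar)) \<le> \<eta>"
    using P_near[OF z\<delta>] P_subgradient_near[OF z\<delta>] by (simp add: algebra_simps)
  then have "(P z, z - \<mu> *\<^sub>R (P z - xbar)) \<in> gph_subdiff f \<inter> cball (xbar, 0) \<eta>"
    using Pair_mem_cballI P_subgradient[OF z\<delta>] by (simp add: gph_subdiff_def)
  then show "second_subderiv f (P z) (z - \<mu> *\<^sub>R (P z - xbar)) w \<ge> ereal (1 / \<kappa> * (norm w)\<^sup>2)"
    using twice_epi_differentiable_P[OF z\<delta> A] gen_quadratic_form_d2[OF z\<delta> A] by (rule bd)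
qed

end

text \<open>Subdifferential continuity is used through a sequence argument: graph points close to
  \<open>(xbar, 0)\<close> satisfy the strict function-value restriction in prox-regularity
  automatically.\<close>

lemma local_prox_exists:
  fixes f :: "'a::euclidean_space \<Rightarrow> ereal"
  assumes pr: "prox_regular f xbar 0" and sc: "subdiff_continuous f xbar 0"
  shows "\<exists>F0 \<epsilon> r. local_prox f xbar F0 \<epsilon> r"
proof -
  obtain F0 where F0: "f xbar = ereal F0"
    using pr by (cases "f xbar") (auto simp: prox_regular_def finite_at_def)
  obtain e1 where e1: "e1 > 0"
    "\<And>\<alpha>::real. ereal \<alpha> \<le> f xbar + ereal e1 \<Longrightarrow> closed {x \<in> cball xbar e1. f x \<le> ereal \<alpha>}"
    using pr unfolding prox_regular_def locally_lsc_def by blast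
  obtain e2 r where e2: "e2 > 0" "r \<ge> 0" and ineq: "\<And>x v x'. (x, v) \<in> gph_subdiff f \<inter> cball (xbar, 0) e2 \<Longrightarrow>
      f x < f xbar + ereal e2 \<Longrightarrow> x' \<in> cball xbar e2 \<Longrightarrow>
      f x' \<ge> f x + ereal (v \<bullet> (x' - x) - r / 2 * (norm (x' - x))\<^sup>2)"
    using pr unfolding prox_regular_def by blast
  have "\<exists>d>0. \<forall>x v. v \<in> limiting_subdiff f x \<and> norm (x - xbar) \<le> d \<and> norm v \<le> d \<longrightarrow> f x < f xbar + ereal e2"
  proof (rule ccontr)
    assume no: "\<not> ?thesis"
    have "\<exists>x v. v \<in> limiting_subdiff f x \<and> norm (x - xbar) \<le> 1 / Suc n \<and> norm v \<le> 1 / Suc n \<and>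
        \<not> f x < f xbar + ereal e2" for n
      using no by (metis of_nat_0_less_iff zero_less_Suc zero_less_divide_1_iff)
    then obtain X V where XV: "\<And>n. V n \<in> limiting_subdiff f (X n)" "\<And>n. norm (X n - xbar) \<le> 1 / Suc n"
      "\<And>n. norm (V n) \<le> 1 / Suc n" "\<And>n. \<not> f (X n) < f xbar + ereal e2"
      by metis
    have z: "(\<lambda>n. 1 / real (Suc n)) \<longlonglongrightarrow> 0" by (rule LIMSEQ_Suc[OF lim_const_over_n])
    have "X \<longlonglongrightarrow> xbar"
      by (rule LIM_zero_cancel[OF Lim_null_comparison[OF always_eventually z]]) (use XV(2) in blast)
    moreover have "V \<longlonglongrightarrow> 0"
      by (rule Lim_null_comparison[OF always_eventually z]) (use XV(3) in blast)
    ultimately have "(\<lambda>n. f (X n)) \<longlonglongrightarrow> f xbar"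
      using sc XV(1) unfolding subdiff_continuous_def by (blast intro: tendsto_Pair)
    from order_tendstoD(2)[OF this, of "f xbar + ereal e2"] XV(4) e2(1) show False by (simp add: F0)
  qed
  then obtain d where d: "d > 0" "\<And>x v. v \<in> limiting_subdiff f x \<Longrightarrow> norm (x - xbar) \<le> d \<Longrightarrow>
      norm v \<le> d \<Longrightarrow> f x < f xbar + ereal e2" by blast
  \<comment> \<open>Half of \<open>e2\<close> is taken because the distance of a pair is estimated
    by the sum of two norms, each at most \<open>\<epsilon>\<close>.\<close>
  define \<epsilon> where "\<epsilon> = Min {1, e1, e2 / 2, d}"
  have \<epsilon>: "\<epsilon> > 0" "\<epsilon> \<le> 1" "\<epsilon> \<le> e1" "\<epsilon> \<le> e2 / 2" "\<epsilon> \<le> d"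
    using e1(1) e2(1) d(1) by (simp_all add: \<epsilon>_def)
  have "local_prox f xbar F0 \<epsilon> r"
  proof
    fix \<alpha> assume "\<alpha> \<le> F0 + \<epsilon>"
    then have "closed (cball xbar \<epsilon> \<inter> {x \<in> cball xbar e1. f x \<le> ereal \<alpha>})"
      using \<epsilon>(3) by (intro closed_Int closed_cball e1(2)) (simp add: F0)
    moreover have "cball xbar \<epsilon> \<inter> {x \<in> cball xbar e1. f x \<le> ereal \<alpha>} = {x \<in> cball xbar \<epsilon>. f x \<le> ereal \<alpha>}"
      using \<epsilon>(3) by auto
    ultimately show "closed {x \<in> cball xbar \<epsilon>. f x \<le> ereal \<alpha>}" by simp
  next
    show "0 \<in> limiting_subdiff f xbar" using pr by (simp add: prox_regular_def)
  next
    fix x v x' assume v: "v \<in> limiting_subdiff f x" "norm (x - xbar) \<le> \<epsilon>" "norm v \<le> \<epsilon>"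
      and x': "x' \<in> cball xbar \<epsilon>"
    show "f x' \<ge> f x + ereal (v \<bullet> (x' - x) - r / 2 * (norm (x' - x))\<^sup>2)"
    proof (rule ineq)
      show "(x, v) \<in> gph_subdiff f \<inter> cball (xbar, 0) e2"
        using v \<epsilon>(4) Pair_mem_cballI[of x xbar v e2] by (simp add: gph_subdiff_def)
      show "f x < f xbar + ereal e2" using d(2)[OF v(1)] v \<epsilon>(5) by simp
      show "x' \<in> cball xbar e2" using x' \<epsilon>(4) e2(1) by simp
    qed
  qed (use \<epsilon> e2 F0 in auto)
  then show ?thesis by blast
qed

theorem theorem3p5:
  fixes f :: "'a::euclidean_space \<Rightarrow> ereal" and xbar :: 'a and \<kappa> :: real
  assumes "prox_regular f xbar 0"
    and "subdiff_continuous f xbar 0"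
    and "\<kappa> > 0"
  defines "a \<equiv> tilt_stable_minimizer f xbar \<kappa>"
    and "b \<equiv> (\<exists>\<eta>>0. \<forall>w. \<forall>(x, v) \<in> gph_subdiff f \<inter> cball (xbar, 0) \<eta>.
           twice_epi_differentiable f x v \<longrightarrow>
             second_subderiv f x v w \<ge> ereal (1 / \<kappa> * (norm w)\<^sup>2))"
    and "c \<equiv> (\<exists>\<eta>>0. \<forall>w. \<forall>(x, v) \<in> gph_subdiff f \<inter> cball (xbar, 0) \<eta>.
           gen_quadratic_form (second_subderiv f x v) \<longrightarrow>
             second_subderiv f x v w \<ge> ereal (1 / \<kappa> * (norm w)\<^sup>2))"
  shows "(a \<longleftrightarrow> b) \<and> (b \<longleftrightarrow> c)"
proof -
  obtain F0 \<epsilon> r where "local_prox f xbar F0 \<epsilon> r" using local_prox_exists[OF assms(1,2)] by blast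
  then interpret local_prox f xbar F0 \<epsilon> r .
  have ab: "b \<and> c" if hyp: a
  proof -
    obtain \<eta> where \<eta>: "\<eta> > 0" and bd: "\<And>x v w. v \<in> limiting_subdiff f x \<and> norm (x - xbar) \<le> \<eta> \<and> norm v \<le> \<eta> \<longrightarrow>
        second_subderiv f x v w \<ge> ereal (1 / \<kappa> * (norm w)\<^sup>2)"
      using second_subderiv_ge_of_tilt_stable[OF hyp[unfolded a_def] assms(3)] by blast
    have "second_subderiv f x v w \<ge> ereal (1 / \<kappa> * (norm w)\<^sup>2)"
      if "(x, v) \<in> gph_subdiff f \<inter> cball (xbar, 0) \<eta>" for x v w
      using that bd Pair_mem_cballD[of x v xbar \<eta>] by (simp add: gph_subdiff_def)
    then show ?thesis unfolding b_def c_def using \<eta> by blast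
  qed
  have "a" if hyp: b
  proof -
    obtain \<eta> where \<eta>: "\<eta> > 0" and bd: "\<forall>w. \<forall>(x, v) \<in> gph_subdiff f \<inter> cball (xbar, 0) \<eta>.
           twice_epi_differentiable f x v \<longrightarrow> second_subderiv f x v w \<ge> ereal (1 / \<kappa> * (norm w)\<^sup>2)"
      using hyp unfolding b_def by blast
    have "second_subderiv f x v w \<ge> ereal (1 / \<kappa> * (norm w)\<^sup>2)"
      if "(x, v) \<in> gph_subdiff f \<inter> cball (xbar, 0) \<eta>" "twice_epi_differentiable f x v" for x v w
      using bspec[OF spec[OF bd, of w] that(1)] that(2) by simp
    then show ?thesis unfolding a_def by (intro tilt_stable_of_generic_bound[OF assms(3) \<eta>])
  qed
  moreover have "a" if hyp: c
  proof -
    obtain \<eta> where \<eta>: "\<eta> > 0" and bd: "\<forall>w. \<forall>(x, v) \<in> gph_subdiff f \<inter> cball (xbar, 0) \<eta>.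
           gen_quadratic_form (second_subderiv f x v) \<longrightarrow> second_subderiv f x v w \<ge> ereal (1 / \<kappa> * (norm w)\<^sup>2)"
      using hyp unfolding c_def by blast
    have "second_subderiv f x v w \<ge> ereal (1 / \<kappa> * (norm w)\<^sup>2)"
      if "(x, v) \<in> gph_subdiff f \<inter> cball (xbar, 0) \<eta>" "gen_quadratic_form (second_subderiv f x v)" for x v w
      using bspec[OF spec[OF bd, of w] that(1)] that(2) by simp
    then show ?thesis unfolding a_def by (intro tilt_stable_of_generic_bound[OF assms(3) \<eta>])
  qed
  ultimately show ?thesis using ab by blast
qed

end
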